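(* Let $\Gamma=\langle\alpha_1,\ldots,\alpha_r\rangle\subset A$. For each $j\in\Delta(\Gamma)$, the set $$\{\alpha\in\Gamma: j\in\Delta(\alpha)\}\subset\Gamma$$ is a disjoint union of finitely many cones.
   Context: $\mathbb N=\{0,1,2,\ldots\}$, $T$ is a finite abelian group, $d\ge1$, and $A=\mathbb N^d\oplus T$. $\Gamma=\langle\alpha_1,\ldots,\alpha_r\rangle\subset A$ is a finitely generated subsemigroup (containing $0$) that is reduced ($0$ is its only invertible element), with unique minimal generating set $\alpha_1,\ldots,\alpha_r$. A factorization of $\alpha\in\Gamma$ is a tuple $\mathbf a\in\mathbb N^r$ with $\alpha=a_1\alpha_1+\cdots+a_r\alpha_r$; its length is $|\mathbf a|=a_1+\cdots+a_r$. $\mathsf L_\Gamma(\alpha)$ is the set of lengths of factorizations of $\alpha$. Writing $\mathsf L_\Gamma(\alpha)=\{\ell_1<\cdots<\ell_m\}$, the delta set of $\alpha$ is $\Delta(\alpha)=\{\ell_{i+1}-\ell_i:1\le i<m\}$, and $\Delta(\Gamma)=\bigcup_{\alpha\in\Gamma}\Delta(\alpha)$. A cone in $A$ is a set of the form $C(\beta;\gamma_1,\ldots,\gamma_s)=\{\beta+\sum_{j=1}^s c_j\gamma_j:c_1,\ldots,c_s\in\mathbb N\}$ with $\beta\in A$ and $\gamma_1,\ldots,\gamma_s\in A$ linearly independent over $\mathbb Z$ ($s\ge0$; for $s=0$ it is the single point $\beta$). *)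

theory Defs
  imports "HOL-Analysis.Analysis"
begin

section \<open>Multiples in commutative monoids and abelian groups\<close>

definition nsmul :: "nat \<Rightarrow> 'a::comm_monoid_add \<Rightarrow> 'a" where
  "nsmul n x = (\<Sum>i<n. x)"

definition zsmul :: "int \<Rightarrow> 'a::ab_group_add \<Rightarrow> 'a" where
  "zsmul k x = nsmul (nat k) x - nsmul (nat (- k)) x"

lemma nsmul_0 [simp]: "nsmul 0 x = 0"
  and nsmul_Suc [simp]: "nsmul (Suc n) x = x + nsmul n x"
  by (simp_all add: nsmul_def add.commute)

lemma nsmul_add_left: "nsmul (m + n) x = nsmul m x + nsmul n x"
  by (induction m) (simp_all add: add.assoc)

lemma nsmul_add_right: "nsmul n (x + y) = nsmul n x + nsmul n y"
  by (simp add: nsmul_def sum.distrib)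

lemma nsmul_mult: "nsmul (m * n) x = nsmul m (nsmul n x)"
  by (induction m) (simp_all add: nsmul_add_left)

lemma zsmul_diff: "zsmul (int m - int n) x = nsmul m x - nsmul n x"
proof (cases "n \<le> m")
  case True
  then obtain k where "m = n + k" using le_Suc_ex by blast
  then show ?thesis by (simp add: zsmul_def nsmul_add_left)
next
  case False
  then obtain k where "n = m + k" using le_Suc_ex by (metis nat_le_linear)
  then show ?thesis by (simp add: zsmul_def nsmul_add_left)
qed

lemma nsmul_diff: "nsmul n (x - y) = nsmul n x - nsmul n (y::'a::ab_group_add)"
  by (simp add: nsmul_def sum_subtractf)

text \<open>Every abelian group is a \<open>\<int>\<close>-module; this makes the library's notion of linear independence
  over \<open>\<int>\<close> available as \<open>int_module.independent\<close>.\<close>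

interpretation int_module: module "zsmul :: int \<Rightarrow> 'a::ab_group_add \<Rightarrow> 'a"
proof
  fix a b :: int and x y :: 'a
  obtain m n where a: "a = int m - int n" by (rule int_diff_cases)
  obtain p q where b: "b = int p - int q" by (rule int_diff_cases)
  show "zsmul a (x + y) = zsmul a x + zsmul a y"
    by (simp add: zsmul_def nsmul_add_right)
  have "a + b = int (m + p) - int (n + q)" by (simp add: a b)
  then show "zsmul (a + b) x = zsmul a x + zsmul b x"
    by (simp only: a b zsmul_diff nsmul_add_left) simp
  have "a * b = int (m * p + n * q) - int (m * q + n * p)"
    by (simp add: a b algebra_simps)
  then show "zsmul a (zsmul b x) = zsmul (a * b) x"
    by (simp only: a b zsmul_diff nsmul_add_left nsmul_mult nsmul_diff) simp
  show "zsmul 1 x = x"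
    by (simp add: zsmul_def)
qed

section \<open>Finitely generated monoids and factorization lengths\<close>

inductive_set submonoid_gen :: "'a::comm_monoid_add set \<Rightarrow> 'a set" for S where
  zero: "0 \<in> submonoid_gen S"
| gen: "x \<in> S \<Longrightarrow> x \<in> submonoid_gen S"
| add: "x \<in> submonoid_gen S \<Longrightarrow> y \<in> submonoid_gen S \<Longrightarrow> x + y \<in> submonoid_gen S"

definition reduced_monoid :: "'a::comm_monoid_add set \<Rightarrow> bool" where
  "reduced_monoid M \<longleftrightarrow> (\<forall>x\<in>M. \<forall>y\<in>M. x + y = 0 \<longrightarrow> x = 0)"

definition minimal_generators :: "'a::comm_monoid_add list \<Rightarrow> bool" where
  "minimal_generators as \<longleftrightarrow>
     distinct as \<and> (\<forall>S. S \<subset> set as \<longrightarrow> submonoid_gen S \<noteq> submonoid_gen (set as))"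

definition factorizations :: "'a::comm_monoid_add list \<Rightarrow> 'a \<Rightarrow> nat list set" where
  "factorizations as x =
     {a. length a = length as \<and> x = (\<Sum>i<length as. nsmul (a ! i) (as ! i))}"

definition length_set :: "'a::comm_monoid_add list \<Rightarrow> 'a \<Rightarrow> nat set" where
  "length_set as x = sum_list ` factorizations as x"

definition successive_diffs :: "nat set \<Rightarrow> nat set" where
  "successive_diffs L = {l' - l | l l'. l \<in> L \<and> l' \<in> L \<and> l < l' \<and> L \<inter> {l<..<l'} = {}}"

text \<open>For a finite set \<open>l\<^sub>1 < \<dots> < l\<^sub>m\<close> these are the numbers \<open>l\<^sub>i\<^sub>+\<^sub>1 - l\<^sub>i\<close>.\<close>

lemma successive_diffs_sorted_list:
  fixes L :: "nat set"
  assumes "finite L"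
  defines "ls \<equiv> sorted_list_of_set L"
  shows "successive_diffs L = {ls ! Suc i - ls ! i | i. Suc i < length ls}"
proof -
  have set: "set ls = L" and sl: "sorted_wrt (<) ls"
    using assms strict_sorted_list_of_set[of L] by (simp_all add: ls_def)
  have less_iff: "ls ! i < ls ! j \<longleftrightarrow> i < j" if "i < length ls" "j < length ls" for i j
    using sl that by (metis sorted_wrt_nth_less linorder_less_linear order_less_asym)
  show ?thesis
  proof (intro equalityI subsetI)
    fix d assume "d \<in> successive_diffs L"
    then obtain l l' where l: "d = l' - l" "l \<in> L" "l' \<in> L" "l < l'" "L \<inter> {l<..<l'} = {}"
      unfolding successive_diffs_def by blast
    from l set obtain i j where ij: "i < length ls" "l = ls ! i" "j < length ls" "l' = ls ! j"
      by (metis in_set_conv_nth)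
    have "i < j" using less_iff ij l(4) by blast
    have "j = Suc i"
    proof (rule ccontr)
      assume "j \<noteq> Suc i"
      with \<open>i < j\<close> have "Suc i < j" by simp
      then have "ls ! Suc i \<in> L \<inter> {l<..<l'}"
        using ij less_iff[of i "Suc i"] less_iff[of "Suc i" j] set by (auto intro: nth_mem)
      with l(5) show False by blast
    qed
    with ij l(1) show "d \<in> {ls ! Suc i - ls ! i | i. Suc i < length ls}" by blast
  next
    fix d assume "d \<in> {ls ! Suc i - ls ! i | i. Suc i < length ls}"
    then obtain i where i: "d = ls ! Suc i - ls ! i" "Suc i < length ls" by blast
    have "L \<inter> {ls ! i<..<ls ! Suc i} = {}"
    proof (rule ccontr)
      assume "L \<inter> {ls ! i<..<ls ! Suc i} \<noteq> {}"
      then obtain k where "k < length ls" "ls ! i < ls ! k" "ls ! k < ls ! Suc i"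
        using set by (auto simp: in_set_conv_nth)
      then show False using less_iff[of i k] less_iff[of k "Suc i"] i(2) by simp
    qed
    moreover have "ls ! i \<in> L" "ls ! Suc i \<in> L" "ls ! i < ls ! Suc i"
      using i(2) set less_iff[of i "Suc i"] by auto
    ultimately show "d \<in> successive_diffs L"
      unfolding successive_diffs_def i(1) by blast
  qed
qed

definition delta :: "'a::comm_monoid_add list \<Rightarrow> 'a \<Rightarrow> nat set" where
  "delta as x = successive_diffs (length_set as x)"

definition delta_monoid :: "'a::comm_monoid_add list \<Rightarrow> nat set" where
  "delta_monoid as = (\<Union>x\<in>submonoid_gen (set as). delta as x)"

section \<open>Cones in \<open>\<nat>\<^sup>d \<oplus> T\<close>\<close>

text \<open>The monoid \<open>\<nat>\<^sup>d \<oplus> T\<close> is the type \<open>(nat ^ 'd) \<times> 't\<close>. Linear independence over \<open>\<int>\<close> is meant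
  in the ambient group \<open>\<int>\<^sup>d \<oplus> T\<close>.\<close>

definition to_group :: "(nat ^ 'd) \<times> 't \<Rightarrow> (int ^ 'd) \<times> 't" where
  "to_group x = (\<chi> i. int (fst x $ i), snd x)"

text \<open>The generators form a set: a linearly independent family has no repetitions,
  and \<open>to_group\<close> is injective.\<close>

definition cone :: "'a::comm_monoid_add \<Rightarrow> 'a set \<Rightarrow> 'a set" where
  "cone b G = {b + (\<Sum>g\<in>G. nsmul (c g) g) | c. True}"

definition is_cone :: "((nat ^ 'd::finite) \<times> 't::ab_group_add) set \<Rightarrow> bool" where
  "is_cone C \<longleftrightarrow>
     (\<exists>b G. finite G \<and> int_module.independent (to_group ` G) \<and> C = cone b G)"

end

theory Submission
  imports Defs
begin

text \<open>Whether \<open>j\<close> lies in the delta set of \<open>\<alpha>\<close> is a statement about the graph of the length function: the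
  set of all \<open>(\<alpha>, l)\<close> with \<open>l\<close> the length of a factorization of \<open>\<alpha>\<close>. Inside the group
  \<open>\<int>\<^sup>d \<oplus> T \<oplus> \<int>\<close> this graph is the monoid generated by the pairs \<open>(\<alpha>\<^sub>i, 1)\<close>, and
  \<open>j \<in> \<Delta>(\<alpha>)\<close> says that for some \<open>l\<close> the points \<open>(\<alpha>, l)\<close> and \<open>(\<alpha>, l + j)\<close> belong to it while the
  points strictly between do not. So the set in question comes from a finitely generated
  monoid by Boolean operations, translations and one projection. The proof has two halves.

  The first half shows that this set is a Presburger set, in the following semantic form: for some
  \<open>m > 0\<close> and finitely many half-spaces, membership of a point depends only on its class
  modulo \<open>m\<close> times the group and on the half-spaces that contain it. Such sets are
  closed under Boolean operations and affine preimages for trivial reasons. The one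
  substantial closure property is \<open>presburger_add_ray\<close>, that \<open>X + \<nat>g\<close> is Presburger if \<open>X\<close> is;
  its proof is Cooper's elimination of one existential quantifier. It yields finitely
  generated monoids (one ray for each generator) as well as the projection (one more ray).

  The second half partitions Presburger subsets of the orthant into cones. The points on
  which all the given half-spaces have prescribed truth values form a set \<open>Y\<close> that is closed under
  adding the elements of a monoid \<open>H\<close>, cut out by homogeneous inequalities and
  congruences. By Dickson's lemma \<open>H\<close> is finitely generated and \<open>Y\<close> is a finite
  union of translates \<open>b + H\<close> of the same monoid. Since the union of the earlier translates is
  closed under adding elements of \<open>H\<close>, everything reduces to \<open>cone_partitioned_Diff\<close>: if \<open>H\<close> is
  finitely generated and \<open>Z + H \<subseteq> Z\<close>, then \<open>(b + H) - Z\<close> is a finite disjoint union of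
  cones. That is proved by induction on the number of generators, slicing along one of them; by
  Noetherianity the slices are eventually translates of each other.\<close>

section \<open>Multiples and additive maps\<close>

lemma zsmul_of_nat: "zsmul (int n) x = nsmul n x"
  by (simp add: zsmul_def)

lemma nsmul_int: "nsmul n (k::int) = int n * k"
  by (simp add: nsmul_def)

lemma fst_nsmul: "fst (nsmul n x) = nsmul n (fst x)"
  and snd_nsmul: "snd (nsmul n x) = nsmul n (snd x)"
  by (induction n) simp_all

lemma nsmul_Pair: "nsmul n (a, b) = (nsmul n a, nsmul n b)"
  by (induction n) (simp_all add: zero_prod_def)

lemma fst_zsmul: "fst (zsmul k x) = zsmul k (fst x)"
  and snd_zsmul: "snd (zsmul k x) = zsmul k (snd x)"
  by (simp_all add: zsmul_def fst_nsmul snd_nsmul)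

lemma additive_nsmul:
  assumes "Modules.additive f"
  shows "f (nsmul n x) = nsmul n (f x)"
  by (induction n) (simp_all add: additive.add[OF assms] additive.zero[OF assms])

lemma additive_zsmul:
  fixes f :: "'a::ab_group_add \<Rightarrow> int"
  assumes "Modules.additive f"
  shows "f (zsmul k x) = k * f x"
  by (simp add: zsmul_def additive.diff[OF assms] additive_nsmul[OF assms] nsmul_int algebra_simps)

lemma additive_compose: "Modules.additive f \<Longrightarrow> Modules.additive g \<Longrightarrow> Modules.additive (\<lambda>x. f (g x))"
  by (simp add: Modules.additive_def)

lemma additive_uminus: "Modules.additive f \<Longrightarrow> Modules.additive (\<lambda>x. - f x)"
  by (simp add: Modules.additive_def)

lemma additive_scale: "Modules.additive f \<Longrightarrow> Modules.additive (\<lambda>x. a * f x)" for a :: int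
  by (simp add: Modules.additive_def distrib_left)

lemma additive_lincomb:
  "Modules.additive f \<Longrightarrow> Modules.additive g \<Longrightarrow> Modules.additive (\<lambda>x. a * f x - b * g x)" for a b :: int
  by (simp add: Modules.additive_def distrib_left)

section \<open>Presburger sets in an abelian group\<close>

text \<open>A pair \<open>(f, c)\<close> stands for the half-space \<open>c \<le> f x\<close>. Since \<open>x\<close> and \<open>x + m z\<close> are
  arbitrary congruent points, \<open>controls F m X\<close> says that \<open>X\<close> is a union of classes of the equivalence
  relation "congruent modulo \<open>m\<close> and in the same half-spaces of \<open>F\<close>", hence a finite Boolean
  combination of half-spaces and sets periodic modulo \<open>m\<close>. This describes a quantifier-free Presburger
  formula without any syntax, which makes Boolean operations immediate.\<close>

definition controls :: "(('a::ab_group_add \<Rightarrow> int) \<times> int) set \<Rightarrow> int \<Rightarrow> 'a set \<Rightarrow> bool" where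
  "controls F m X \<longleftrightarrow> finite F \<and> (\<forall>(f, c)\<in>F. Modules.additive f) \<and> 0 < m \<and>
     (\<forall>x z. (\<forall>(f, c)\<in>F. c \<le> f x \<longleftrightarrow> c \<le> f (x + zsmul m z)) \<longrightarrow> (x \<in> X \<longleftrightarrow> x + zsmul m z \<in> X))"

definition presburger :: "'a::ab_group_add set \<Rightarrow> bool" where
  "presburger X \<longleftrightarrow> (\<exists>F m. controls F m X)"

lemma controlsD:
  assumes "controls F m X"
  shows "finite F" "0 < m" "(f, c) \<in> F \<Longrightarrow> Modules.additive f"
    and "(\<And>f c. (f, c) \<in> F \<Longrightarrow> c \<le> f x \<longleftrightarrow> c \<le> f (x + zsmul m z)) \<Longrightarrow> x \<in> X \<longleftrightarrow> x + zsmul m z \<in> X"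
  using assms unfolding controls_def by blast+

lemma controls_mono:
  assumes "controls F m X" "finite F'" "F \<subseteq> F'" "\<forall>(f, c)\<in>F'. Modules.additive f" "0 < k"
  shows "controls F' (m * k) X"
proof -
  have scale: "zsmul (m * k) z = zsmul m (zsmul k z)" for z :: 'a
    by simp
  have "x \<in> X \<longleftrightarrow> x + zsmul (m * k) z \<in> X"
    if "\<forall>(f, c)\<in>F'. c \<le> f x \<longleftrightarrow> c \<le> f (x + zsmul (m * k) z)" for x z
  proof -
    have "\<forall>(f, c)\<in>F. c \<le> f x \<longleftrightarrow> c \<le> f (x + zsmul m (zsmul k z))"
      using that assms(3) unfolding scale by blast
    then show ?thesis
      using assms(1) unfolding controls_def scale by blast
  qed
  then show ?thesis
    using assms unfolding controls_def by auto
qed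

lemma presburger_Compl:
  assumes "presburger X"
  shows "presburger (- X)"
  using assms unfolding presburger_def controls_def by simp

lemma presburger_Int:
  assumes "presburger X" "presburger Y"
  shows "presburger (X \<inter> Y)"
proof -
  obtain F m G k where X: "controls F m X" and Y: "controls G k Y"
    using assms unfolding presburger_def by blast
  then have FG: "finite (F \<union> G)" "\<forall>(f, c)\<in>F \<union> G. Modules.additive f" "0 < m" "0 < k"
    unfolding controls_def by auto
  have "controls (F \<union> G) (m * k) X" "controls (F \<union> G) (m * k) Y"
    using controls_mono[OF X FG(1) _ FG(2,4)] controls_mono[OF Y FG(1) _ FG(2,3)]
    by (simp_all add: mult.commute)
  then have "controls (F \<union> G) (m * k) (X \<inter> Y)"
    unfolding controls_def by blast
  then show ?thesis unfolding presburger_def by blast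
qed

lemma presburger_UNIV: "presburger UNIV"
  unfolding presburger_def controls_def by (rule exI[of _ "{}"], rule exI[of _ 1]) simp

lemma presburger_INT:
  assumes "finite I" "\<And>i. i \<in> I \<Longrightarrow> presburger (S i)"
  shows "presburger (\<Inter>i\<in>I. S i)"
  using assms by (induction I) (simp_all add: presburger_UNIV presburger_Int)

lemma presburger_vimage:
  assumes "presburger X" "Modules.additive h"
  shows "presburger {x. h x + t \<in> X}"
proof -
  obtain F m where F: "controls F m X"
    using assms unfolding presburger_def by blast
  have "h (zsmul m z) = zsmul m (h z)" for z
    by (simp add: zsmul_def additive.diff[OF assms(2)] additive_nsmul[OF assms(2)])
  then have h: "h (x + zsmul m z) + t = (h x + t) + zsmul m (h z)" for x z
    by (simp add: additive.add[OF assms(2)] ac_simps)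
  have "h x + t \<in> X \<longleftrightarrow> h (x + zsmul m z) + t \<in> X"
    if agree: "\<forall>(f, c)\<in>(\<lambda>(f, c). (\<lambda>x. f (h x), c - f t)) ` F. c \<le> f x \<longleftrightarrow> c \<le> f (x + zsmul m z)" for x z
  proof -
    have "c \<le> f (h x + t) \<longleftrightarrow> c \<le> f (h x + t + zsmul m (h z))" if "(f, c) \<in> F" for f c
    proof -
      have f: "Modules.additive f" using that F unfolding controls_def by auto
      have "(c - f t \<le> f (h x)) = (c - f t \<le> f (h (x + zsmul m z)))"
        using agree that by force
      then have "c \<le> f (h x + t) \<longleftrightarrow> c \<le> f (h (x + zsmul m z) + t)"
        by (simp add: additive.add[OF f] diff_le_eq)
      then show ?thesis by (simp only: h)
    qed
    then have "\<forall>(f, c)\<in>F. c \<le> f (h x + t) \<longleftrightarrow> c \<le> f (h x + t + zsmul m (h z))"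
      by blast
    then have "h x + t \<in> X \<longleftrightarrow> h x + t + zsmul m (h z) \<in> X"
      using F unfolding controls_def by blast
    then show ?thesis by (simp only: h)
  qed
  moreover have "Modules.additive f'" if fc': "(f', c') \<in> (\<lambda>(f, c). (\<lambda>x. f (h x), c - f t)) ` F" for f' c'
  proof -
    obtain p where p: "p \<in> F" "(f', c') = (\<lambda>(f, c). (\<lambda>x. f (h x), c - f t)) p"
      using fc' by blast
    then have "Modules.additive (fst p)" "f' = (\<lambda>x. fst p (h x))"
      using F unfolding controls_def by (auto simp: case_prod_beta)
    then show ?thesis
      using additive_compose[OF _ assms(2)] by simp
  qed
  ultimately have "controls ((\<lambda>(f, c). (\<lambda>x. f (h x), c - f t)) ` F) m {x. h x + t \<in> X}"
    using F unfolding controls_def by blast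
  then show ?thesis unfolding presburger_def by blast
qed

text \<open>Cooper's quantifier elimination. Suppose that \<open>x - n g \<in> X\<close> with \<open>n\<close> least. If \<open>n < m\<close>, then \<open>n\<close> is
  one of finitely many values, and the half-spaces of \<open>F1\<close> transfer the membership to a point
  equivalent to \<open>x\<close>. If \<open>n \<ge> m\<close>, then \<open>x - (n - m) g\<close> is congruent to \<open>x - n g\<close>
  and by minimality not in \<open>X\<close>, so the boundary of some half-space \<open>(f, c)\<close> separates the two points.
  Hence \<open>f (x - n g)\<close> is one of finitely many values close to \<open>c\<close>, and \<open>n\<close> is determined by this
  value \<open>e\<close> through \<open>n \<cdot> f g = f x - e\<close>. Multiplying the remaining conditions by
  \<open>\<bar>f g\<bar>\<close> removes the division; this gives the half-spaces of \<open>F2\<close> (stating \<open>n \<ge> 0\<close>) and \<open>F3\<close>.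
  The sign \<open>\<sigma>\<close> of \<open>f g\<close> makes the multiplier positive, and \<open>k = \<sigma> e\<close>. The new modulus contains all the
  factors \<open>\<bar>f g\<bar>\<close>, so that the solution \<open>n\<close> for an equivalent point is again an integer.\<close>

lemma presburger_add_ray:
  assumes "presburger X"
  shows "presburger {y. \<exists>n. y - nsmul n g \<in> X}"
proof -
  obtain F m where "controls F m X"
    using assms unfolding presburger_def by blast
  note fin = controlsD(1)[OF this] and m = controlsD(2)[OF this]
    and addF = controlsD(3)[OF this] and ctrl = controlsD(4)[OF this]
  define K where "K = (\<Sum>(f, c)\<in>F. \<bar>c\<bar> + m * \<bar>f g\<bar>)"
  define Q where "Q = (\<Prod>(f, c)\<in>{(f, c)\<in>F. f g \<noteq> 0}. \<bar>f g\<bar>)"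
  define F1 where "F1 = (\<lambda>((f, c), n). (f, c + int n * f g)) ` (F \<times> {..<nat m})"
  define F2 where "F2 = (\<lambda>((f, c), \<sigma>, k). (\<lambda>x. \<sigma> * f x, k)) ` (F \<times> {- 1, 1} \<times> {- K..K})"
  define F3 where "F3 = (\<lambda>((f, c), (f', c'), \<sigma>, k).
      (\<lambda>x. (\<sigma> * f g) * f' x - f' g * (\<sigma> * f x), (\<sigma> * f g) * c' - k * f' g)) `
      (F \<times> F \<times> {- 1, 1} \<times> {- K..K})"
  define Y where "Y = {y. \<exists>n. y - nsmul n g \<in> X}"
  have finP: "finite {(f, c)\<in>F. f g \<noteq> 0}"
    by (rule finite_subset[OF _ fin]) auto
  have Q: "0 < Q"
    unfolding Q_def by (rule prod_pos) auto
  have fin': "finite (F1 \<union> F2 \<union> F3)"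
    unfolding F1_def F2_def F3_def using fin by simp
  have "Modules.additive f" if "(f, c) \<in> F1 \<union> F2 \<union> F3" for f c
    using that addF unfolding F1_def F2_def F3_def
    by (auto intro!: additive_scale additive_lincomb)
  then have add': "\<forall>(f, c)\<in>F1 \<union> F2 \<union> F3. Modules.additive f"
    by blast
  have step: "x + zsmul (m * Q) z \<in> Y"
    if agree: "\<forall>(f, c)\<in>F1 \<union> F2 \<union> F3. c \<le> f x \<longleftrightarrow> c \<le> f (x + zsmul (m * Q) z)"
      and x: "x \<in> Y" for x z
  proof -
    define x' where "x' = x + zsmul (m * Q) z"
    have fx': "f x' = f x + m * Q * f z" if "Modules.additive f" for f
      by (simp add: x'_def additive.add[OF that] additive_zsmul[OF that])
    have agree: "c \<le> f x \<longleftrightarrow> c \<le> f x'" if "(f, c) \<in> F1 \<union> F2 \<union> F3" for f c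
      using agree that unfolding x'_def by blast
    define n where "n = (LEAST n. x - nsmul n g \<in> X)"
    have n: "x - nsmul n g \<in> X"
      using x unfolding Y_def n_def by (auto intro: LeastI_ex)
    have "\<exists>n'. x' - nsmul n' g \<in> X"
    proof (cases "int n < m")
      case True
      have "x - nsmul n g \<in> X \<longleftrightarrow> x - nsmul n g + zsmul m (zsmul Q z) \<in> X"
      proof (rule ctrl)
        fix f c assume fc: "(f, c) \<in> F"
        note f = addF[OF fc]
        have "((f, c), n) \<in> F \<times> {..<nat m}" using fc True by auto
        then have "(f, c + int n * f g) \<in> F1" unfolding F1_def by force
        then have "c + int n * f g \<le> f x \<longleftrightarrow> c + int n * f g \<le> f x'"
          by (intro agree) simp
        then show "c \<le> f (x - nsmul n g) \<longleftrightarrow> c \<le> f (x - nsmul n g + zsmul m (zsmul Q z))"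
          by (simp add: fx'[OF f] additive.add[OF f] additive.diff[OF f] additive_zsmul[OF f]
              additive_nsmul[OF f] nsmul_int algebra_simps)
      qed
      moreover have "x - nsmul n g + zsmul m (zsmul Q z) = x' - nsmul n g"
        by (simp add: x'_def int_module.scale_scale algebra_simps)
      ultimately show ?thesis using n by metis
    next
      case False
      define p where "p = n - nat m"
      have p: "p < n" "int n = int p + m" using False m by (auto simp: p_def)
      have ng: "nsmul n g = nsmul p g + zsmul m g"
        by (simp add: zsmul_of_nat[symmetric] p(2) int_module.scale_left_distrib)
      have "x - nsmul p g \<notin> X"
        using p(1) not_less_Least unfolding n_def by blast
      then have "x - nsmul n g + zsmul m g \<notin> X"
        by (simp add: ng algebra_simps)
      with n obtain f c where fc: "(f, c) \<in> F"
        and cross: "(c \<le> f (x - nsmul n g)) \<noteq> (c \<le> f (x - nsmul n g + zsmul m g))"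
        using ctrl[of "x - nsmul n g" g] by metis
      note f = addF[OF fc]
      define e where "e = f x - int n * f g"
      have cross: "(c \<le> e) \<noteq> (c \<le> e + m * f g)"
        using cross by (simp add: e_def additive.add[OF f] additive.diff[OF f] additive_zsmul[OF f]
              additive_nsmul[OF f] nsmul_int)
      then have fg: "f g \<noteq> 0" by auto
      define \<sigma> where "\<sigma> = sgn (f g)"
      have \<sigma>: "\<sigma> \<in> {- 1, 1}" "\<sigma> * f g = \<bar>f g\<bar>" "\<bar>\<sigma> * e\<bar> = \<bar>e\<bar>"
        using fg by (auto simp: \<sigma>_def sgn_if)
      define q where "q = \<bar>f g\<bar>"
      have q: "0 < q" "\<sigma> * f g = q" using fg \<sigma> by (auto simp: q_def)
      have "q dvd Q"
        unfolding q_def Q_def using dvd_prodI[OF finP, of "(f, c)" "\<lambda>(f, c). \<bar>f g\<bar>"] fc fg by simp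
      then obtain q' where q': "Q = q * q'" by blast
      define k where "k = \<sigma> * e"
      (* e is within m * |f g| of c, because the values e and e + m * f g lie on
         different sides of c. *)
      have "\<bar>e\<bar> \<le> \<bar>c\<bar> + \<bar>m * f g\<bar>" using cross by linarith
      also have "\<dots> = \<bar>c\<bar> + m * \<bar>f g\<bar>" using m by (simp add: abs_mult)
      also have "\<dots> \<le> K"
        unfolding K_def using member_le_sum[OF fc, of "\<lambda>(f, c). \<bar>c\<bar> + m * \<bar>f g\<bar>"] fin m by auto
      finally have kK: "k \<in> {- K..K}" using \<sigma>(3) unfolding k_def by auto
      have \<sigma>x: "\<sigma> * f x = k + int n * q"
        unfolding k_def e_def q(2)[symmetric] by (simp add: algebra_simps)
      (* n' solves the equation of n with x' in place of x; it is an integer since q divides Q. *)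
      define n' where "n' = int n + m * q' * (\<sigma> * f z)"
      have \<sigma>x': "\<sigma> * f x' = k + n' * q"
        using \<sigma>x by (simp add: fx'[OF f] n'_def q' algebra_simps)
      have "(\<lambda>x. \<sigma> * f x, k) \<in> F2"
        unfolding F2_def by (rule image_eqI[of _ _ "((f, c), \<sigma>, k)"]) (use fc \<sigma> kK in auto)
      then have "k \<le> \<sigma> * f x \<longleftrightarrow> k \<le> \<sigma> * f x'"
        using agree[of "\<lambda>x. \<sigma> * f x" k] by simp
      then have "0 \<le> n' * q" using q(1) by (simp add: \<sigma>x \<sigma>x')
      then have n'0: "0 \<le> n'" using q(1) by (simp add: zero_le_mult_iff)
      define w where "w = zsmul Q z - zsmul (q' * (\<sigma> * f z)) g"
      have x'n': "x' - zsmul n' g = x - nsmul n g + zsmul m w"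
        by (simp add: x'_def n'_def w_def int_module.scale_scale int_module.scale_left_distrib
            int_module.scale_right_diff_distrib zsmul_of_nat algebra_simps)
      have "x - nsmul n g \<in> X \<longleftrightarrow> x - nsmul n g + zsmul m w \<in> X"
      proof (rule ctrl)
        fix f' c' assume fc': "(f', c') \<in> F"
        note f' = addF[OF fc']
        have iff: "c' \<le> f' y - l * f' g \<longleftrightarrow>
            q * c' - k * f' g \<le> q * f' y - f' g * (\<sigma> * f y)"
          if "\<sigma> * f y = k + l * q" for y l
        proof -
          have "c' \<le> f' y - l * f' g \<longleftrightarrow> q * c' \<le> q * (f' y - l * f' g)"
            using q(1) by simp
          then show ?thesis unfolding that by (simp add: algebra_simps)
        qed
        have "(\<lambda>x. q * f' x - f' g * (\<sigma> * f x), q * c' - k * f' g) \<in> F3"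
          unfolding F3_def
          by (rule image_eqI[of _ _ "((f, c), (f', c'), \<sigma>, k)"]) (use fc fc' \<sigma> kK q in auto)
        then have "q * c' - k * f' g \<le> q * f' x - f' g * (\<sigma> * f x) \<longleftrightarrow>
            q * c' - k * f' g \<le> q * f' x' - f' g * (\<sigma> * f x')"
          using agree[of "\<lambda>x. q * f' x - f' g * (\<sigma> * f x)"] by simp
        then have "c' \<le> f' (x - nsmul n g) \<longleftrightarrow> c' \<le> f' (x' - zsmul n' g)"
          using iff[OF \<sigma>x] iff[OF \<sigma>x']
          by (simp add: additive.diff[OF f'] additive_zsmul[OF f'] additive_nsmul[OF f'] nsmul_int)
        then show "c' \<le> f' (x - nsmul n g) \<longleftrightarrow> c' \<le> f' (x - nsmul n g + zsmul m w)"
          unfolding x'n' .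
      qed
      then have "x' - zsmul n' g \<in> X" using n x'n' by simp
      then have "x' - nsmul (nat n') g \<in> X"
        using n'0 by (simp add: zsmul_of_nat[symmetric])
      then show ?thesis by blast
    qed
    then show ?thesis unfolding Y_def x'_def by simp
  qed
  have "x \<in> Y \<longleftrightarrow> x + zsmul (m * Q) z \<in> Y"
    if agree: "\<forall>(f, c)\<in>F1 \<union> F2 \<union> F3. c \<le> f x \<longleftrightarrow> c \<le> f (x + zsmul (m * Q) z)" for x z
  proof
    assume "x \<in> Y" then show "x + zsmul (m * Q) z \<in> Y" by (rule step[OF agree])
  next
    assume "x + zsmul (m * Q) z \<in> Y"
    moreover have "x + zsmul (m * Q) z + zsmul (m * Q) (- z) = x" by simp
    ultimately show "x \<in> Y"
      using step[of "x + zsmul (m * Q) z" "- z"] agree by auto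
  qed
  then have "controls (F1 \<union> F2 \<union> F3) (m * Q) Y"
    unfolding controls_def using fin' add' m Q by simp
  then show ?thesis unfolding presburger_def Y_def by blast
qed

section \<open>Dickson's lemma\<close>

text \<open>Choose repeatedly an index beyond the previous one at which \<open>s\<close> is minimal among all later
  values.\<close>

lemma nat_monotone_subsequence:
  fixes s :: "nat \<Rightarrow> nat"
  shows "\<exists>r :: nat \<Rightarrow> nat. strict_mono r \<and> (\<forall>i j. i \<le> j \<longrightarrow> s (r i) \<le> s (r j))"
proof -
  have "\<exists>f. \<forall>n. (\<forall>i\<ge>f n. s (f n) \<le> s i) \<and> f n < f (Suc n)"
  proof (rule dependent_nat_choice)
    show "\<exists>x. \<forall>i\<ge>x. s x \<le> s i"
      using ex_has_least_nat[of "\<lambda>_. True" 0 s] by auto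
    fix x n :: nat
    show "\<exists>y. (\<forall>i\<ge>y. s y \<le> s i) \<and> x < y"
      using ex_has_least_nat[of "\<lambda>y. x < y" "Suc x" s] by (metis lessI order_less_le_trans)
  qed
  then obtain r where r: "\<And>n i. i \<ge> r n \<Longrightarrow> s (r n) \<le> s i" "\<And>n. r n < r (Suc n)"
    by blast
  have "strict_mono r" using r(2) by (simp add: strict_mono_Suc_iff)
  moreover have "s (r i) \<le> s (r j)" if "i \<le> j" for i j
    using that r(1) \<open>strict_mono r\<close> by (simp add: strict_mono_less_eq)
  ultimately show ?thesis by blast
qed

lemma Dickson:
  fixes \<phi> :: "'i \<Rightarrow> nat \<Rightarrow> nat"
  assumes "finite I"
  shows "\<exists>r :: nat \<Rightarrow> nat. strict_mono r \<and> (\<forall>k\<in>I. \<forall>i j. i \<le> j \<longrightarrow> \<phi> k (r i) \<le> \<phi> k (r j))"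
  using assms
proof (induction I)
  case empty
  show ?case by (rule exI[of _ "\<lambda>n. n"]) (simp add: strict_mono_def)
next
  case (insert k I)
  obtain r :: "nat \<Rightarrow> nat" where r: "strict_mono r"
    "\<forall>k\<in>I. \<forall>i j. i \<le> j \<longrightarrow> \<phi> k (r i) \<le> \<phi> k (r j)"
    using insert.IH by blast
  obtain t :: "nat \<Rightarrow> nat" where t: "strict_mono t"
    "\<forall>i j. i \<le> j \<longrightarrow> \<phi> k (r (t i)) \<le> \<phi> k (r (t j))"
    using nat_monotone_subsequence[of "\<lambda>n. \<phi> k (r n)"] by blast
  have "strict_mono (r \<circ> t)" using r(1) t(1) by (rule strict_mono_o)
  moreover have "\<phi> l ((r \<circ> t) i) \<le> \<phi> l ((r \<circ> t) j)" if "l \<in> insert k I" "i \<le> j" for l i j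
    using that r(2) t by (auto simp: strict_mono_less_eq)
  ultimately show ?case by blast
qed

text \<open>Read \<open>x - b \<in> H\<close> as \<open>b \<preceq> x\<close>. Without a finite basis one could choose, again and again, an
  element of \<open>X\<close> that lies above none of its predecessors, which produces a bad
  sequence.\<close>

lemma finite_basis:
  fixes X H :: "'a::ab_group_add set"
  assumes good: "\<And>s :: nat \<Rightarrow> 'a. (\<And>n. s n \<in> X) \<Longrightarrow> \<exists>i j. i < j \<and> s j - s i \<in> H"
  shows "\<exists>B. finite B \<and> B \<subseteq> X \<and> (\<forall>x\<in>X. \<exists>b\<in>B. x - b \<in> H)"
proof (rule ccontr)
  assume neg: "\<nexists>B. finite B \<and> B \<subseteq> X \<and> (\<forall>x\<in>X. \<exists>b\<in>B. x - b \<in> H)"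
  have bad: "\<exists>x\<in>X. \<forall>b\<in>B. x - b \<notin> H" if B: "finite B" "B \<subseteq> X" for B
  proof -
    have "\<not> (\<forall>x\<in>X. \<exists>b\<in>B. x - b \<in> H)" using neg B by iprover
    then show ?thesis by simp
  qed
  have "\<exists>s :: nat \<Rightarrow> 'a. \<forall>n. s n \<in> X \<and> (\<forall>i<n. s n - s i \<notin> H)"
  proof (rule dependent_wf_choice[OF wf_less])
    fix n and f :: "nat \<Rightarrow> 'a"
    assume "\<And>y. (y, n) \<in> {(x, y). x < y} \<Longrightarrow> f y \<in> X \<and> (\<forall>i<y. f y - f i \<notin> H)"
    then have "f ` {..<n} \<subseteq> X" by auto
    then show "\<exists>r. r \<in> X \<and> (\<forall>i<n. r - f i \<notin> H)"
      using bad[of "f ` {..<n}"] by auto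
  qed auto
  then obtain s :: "nat \<Rightarrow> 'a" where "\<And>n. s n \<in> X" "\<And>i n. i < n \<Longrightarrow> s n - s i \<notin> H"
    by auto
  then show False using good[of s] by auto
qed

section \<open>Cones with arbitrary finite generating sets\<close>

lemma cone_empty [simp]: "cone b {} = {b}"
  by (simp add: cone_def)

text \<open>Inductions on the number of generators proceed by this slicing along one of them.\<close>

lemma cone_insert:
  assumes "finite G" "g \<notin> G"
  shows "cone b (insert g G) = (\<Union>n. cone (b + nsmul n g) G)"
proof (intro equalityI subsetI)
  fix x assume "x \<in> cone b (insert g G)"
  then obtain c where "x = b + nsmul (c g) g + (\<Sum>h\<in>G. nsmul (c h) h)"
    using assms by (auto simp: cone_def add.assoc)
  then show "x \<in> (\<Union>n. cone (b + nsmul n g) G)"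
    unfolding cone_def by blast
next
  fix x assume "x \<in> (\<Union>n. cone (b + nsmul n g) G)"
  then obtain n c where x: "x = b + nsmul n g + (\<Sum>h\<in>G. nsmul (c h) h)"
    unfolding cone_def by blast
  have "(\<Sum>h\<in>G. nsmul (c h) h) = (\<Sum>h\<in>G. nsmul ((c(g := n)) h) h)"
    using assms by (intro sum.cong) auto
  then have "x = b + (\<Sum>h\<in>insert g G. nsmul ((c(g := n)) h) h)"
    using assms by (simp add: x add.assoc)
  then show "x \<in> cone b (insert g G)"
    unfolding cone_def by blast
qed

lemma coneI: "b + (\<Sum>g\<in>G. nsmul (c g) g) \<in> cone b G"
  unfolding cone_def by blast

lemma apex_in_cone: "b \<in> cone b G"
  using coneI[of b "\<lambda>_. 0" G] by simp

lemma cone_add_generator: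
  assumes "finite G" "x \<in> cone b G" "g \<in> G"
  shows "x + g \<in> cone b G"
proof -
  obtain c where x: "x = b + (\<Sum>h\<in>G. nsmul (c h) h)"
    using assms(2) unfolding cone_def by blast
  have "(\<Sum>h\<in>G. nsmul (c h + (if h = g then 1 else 0)) h)
      = (\<Sum>h\<in>G. nsmul (c h) h) + (\<Sum>h\<in>G. if h = g then h else 0)"
    by (subst sum.distrib[symmetric], rule sum.cong) (auto simp: nsmul_add_left)
  also have "(\<Sum>h\<in>G. if h = g then h else 0) = g"
    using assms by (simp add: sum.delta)
  finally have eq: "x + g = b + (\<Sum>h\<in>G. nsmul (c h + (if h = g then 1 else 0)) h)"
    by (simp add: x add.assoc)
  show ?thesis unfolding eq by (rule coneI)
qed

lemma cone_least:
  assumes "finite G" "b \<in> X" "\<And>x g. x \<in> X \<Longrightarrow> g \<in> G \<Longrightarrow> x + g \<in> X"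
  shows "cone b G \<subseteq> X"
  using assms
proof (induction G arbitrary: b)
  case (insert g G)
  have "b + nsmul n g \<in> X" for n
  proof (induction n)
    case (Suc n)
    then show ?case
      using insert.prems(2)[of "b + nsmul n g" g] by (simp add: ac_simps)
  qed (simp add: insert.prems)
  then have "cone (b + nsmul n g) G \<subseteq> X" for n
    using insert.IH insert.prems by blast
  then show ?case
    using insert.hyps by (auto simp: cone_insert)
qed simp

text \<open>All translates of a cone are described by the one with apex \<open>0\<close>, which is the monoid
  generated by \<open>G\<close>.\<close>

lemma cone_translate: "x \<in> cone b G \<longleftrightarrow> x - b \<in> cone 0 G"
  for x :: "'a::ab_group_add"
  unfolding cone_def by (auto simp: algebra_simps)

lemma closed_add_cone:
  fixes Z :: "'a::ab_group_add set"
  assumes "finite G" "\<And>z g. z \<in> Z \<Longrightarrow> g \<in> G \<Longrightarrow> z + g \<in> Z" "z \<in> Z" "y \<in> cone 0 G"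
  shows "z + y \<in> Z"
proof -
  have "z + y \<in> cone z G" using assms(4) by (simp add: cone_translate[of "z + y"])
  then show ?thesis using cone_least[of G z Z] assms by blast
qed

text \<open>Dickson's lemma applied to the coefficient vectors of the elements of a finitely
  generated monoid.\<close>

lemma cone_good_pair:
  fixes s :: "nat \<Rightarrow> 'a::ab_group_add"
  assumes "finite G" "\<And>n. s n \<in> cone 0 G"
  shows "\<exists>i j. i < j \<and> s j - s i \<in> cone 0 G"
proof -
  obtain c where c: "\<And>n. s n = (\<Sum>g\<in>G. nsmul (c n g) g)"
    using assms(2) unfolding cone_def by (simp, metis)
  obtain r :: "nat \<Rightarrow> nat" where r: "strict_mono r"
    "\<forall>g\<in>G. \<forall>i j. i \<le> j \<longrightarrow> c (r i) g \<le> c (r j) g"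
    using Dickson[OF assms(1), of "\<lambda>g n. c n g"] by blast
  have "s (r 1) = s (r 0) + (\<Sum>g\<in>G. nsmul (c (r 1) g - c (r 0) g) g)"
    unfolding c sum.distrib[symmetric] nsmul_add_left[symmetric]
    using r(2) by (intro sum.cong) auto
  then have "s (r 1) - s (r 0) \<in> cone 0 G"
    unfolding cone_def by auto
  moreover have "r 0 < r 1" using r(1) by (simp add: strict_mono_def)
  ultimately show ?thesis by blast
qed

section \<open>Partitions into cones\<close>

definition cone_partitioned :: "'a::ab_group_add set \<Rightarrow> bool" where
  "cone_partitioned X \<longleftrightarrow>
     (\<exists>\<C>. finite \<C> \<and> disjoint \<C> \<and> \<Union>\<C> = X \<and>
        (\<forall>C\<in>\<C>. \<exists>b G. finite G \<and> int_module.independent G \<and> C = cone b G))"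

lemma cone_partitioned_empty: "cone_partitioned {}"
  unfolding cone_partitioned_def by (rule exI[of _ "{}"]) simp

lemma cone_partitioned_singleton: "cone_partitioned {b}"
  unfolding cone_partitioned_def
  using int_module.independent_empty
  by (intro exI[of _ "{{b}}"]) (auto intro!: exI[of _ b] exI[of _ "{}"] simp del: int_module.dependent_explicit)

lemma cone_partitioned_Un:
  assumes "cone_partitioned X" "cone_partitioned Y" "X \<inter> Y = {}"
  shows "cone_partitioned (X \<union> Y)"
proof -
  obtain \<C> \<D> where
    "finite \<C>" "disjoint \<C>" "\<Union>\<C> = X"
    "\<forall>C\<in>\<C>. \<exists>b G. finite G \<and> int_module.independent G \<and> C = cone b G"
    "finite \<D>" "disjoint \<D>" "\<Union>\<D> = Y"
    "\<forall>C\<in>\<D>. \<exists>b G. finite G \<and> int_module.independent G \<and> C = cone b G"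
    using assms(1,2) unfolding cone_partitioned_def by auto
  then have "finite (\<C> \<union> \<D>) \<and> disjoint (\<C> \<union> \<D>) \<and> \<Union>(\<C> \<union> \<D>) = X \<union> Y \<and>
      (\<forall>C\<in>\<C> \<union> \<D>. \<exists>b G. finite G \<and> int_module.independent G \<and> C = cone b G)"
    using assms(3) disjoint_union[of \<C> \<D>] by (simp add: ball_Un)
  then show ?thesis unfolding cone_partitioned_def by (rule exI)
qed

lemma cone_partitioned_UN:
  assumes "finite I" "\<And>i. i \<in> I \<Longrightarrow> cone_partitioned (S i)" "disjoint_family_on S I"
  shows "cone_partitioned (\<Union>i\<in>I. S i)"
  using assms
proof (induction I)
  case (insert i I)
  have "cone_partitioned (S i \<union> (\<Union>i\<in>I. S i))"
    using insert unfolding disjoint_family_on_def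
    by (intro cone_partitioned_Un) auto
  then show ?case by simp
qed (simp add: cone_partitioned_empty)

text \<open>A relation that involves \<open>g\<close>, with the negative terms moved to the other side, exhibits two
  points of the cone that differ by a positive multiple of \<open>g\<close>.\<close>

lemma independent_insert_ray:
  assumes G: "finite G" "int_module.independent G"
    and ray: "\<And>x y k. x \<in> cone b G \<Longrightarrow> y \<in> cone b G \<Longrightarrow> x = y + nsmul k g \<Longrightarrow> k = 0"
  shows "g \<notin> G" "int_module.independent (insert g G)"
proof -
  show gG: "g \<notin> G"
  proof
    assume "g \<in> G"
    then have "b + g \<in> cone b G"
      by (rule cone_add_generator[OF G(1) apex_in_cone])
    then have "(1::nat) = 0"
      by (rule ray[OF _ apex_in_cone]) simp
    then show False by simp
  qed
  have pos: "u g \<le> 0" if "(\<Sum>v\<in>insert g G. zsmul (u v) v) = 0" for u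
  proof (rule ccontr)
    assume "\<not> u g \<le> 0"
    have "zsmul (u g) g + (\<Sum>v\<in>G. nsmul (nat (u v)) v - nsmul (nat (- u v)) v) = 0"
      using that gG G(1) by (simp add: zsmul_def[symmetric])
    then have "b + (\<Sum>v\<in>G. nsmul (nat (- u v)) v)
        = (b + (\<Sum>v\<in>G. nsmul (nat (u v)) v)) + nsmul (nat (u g)) g"
      using \<open>\<not> u g \<le> 0\<close> by (simp add: zsmul_def sum_subtractf algebra_simps eq_neg_iff_add_eq_0)
    then have "nat (u g) = 0"
      by (rule ray[rotated 2]) (auto simp: cone_def)
    then show False using \<open>\<not> u g \<le> 0\<close> by simp
  qed
  have "u v = 0" if sum0: "(\<Sum>v\<in>insert g G. zsmul (u v) v) = 0" and v: "v \<in> insert g G" for u v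
  proof -
    have "(\<Sum>v\<in>insert g G. zsmul (- u v) v) = 0"
      using sum0 by (simp add: sum_negf)
    then have ug: "u g = 0" using pos[OF sum0] pos[of "\<lambda>v. - u v"] by simp
    then have "(\<Sum>v\<in>G. zsmul (u v) v) = 0"
      using sum0 gG G(1) by simp
    then show ?thesis
      using v ug int_module.independentD[OF G(2,1) subset_refl] by blast
  qed
  then show "int_module.independent (insert g G)"
    using int_module.dependent_finite[of "insert g G"] G(1) by blast
qed

lemma ray_translates:
  fixes g :: "'a::ab_group_add"
  shows "{x + nsmul k g | x k. x \<in> T} = {x. \<exists>k. x - nsmul k g \<in> T}"
proof (intro set_eqI iffI)
  fix x assume "x \<in> {x + nsmul k g | x k. x \<in> T}"
  then obtain y k where "x = y + nsmul k g" "y \<in> T" by blast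
  then have "x - nsmul k g \<in> T" by simp
  then show "x \<in> {x. \<exists>k. x - nsmul k g \<in> T}" by blast
next
  fix x assume "x \<in> {x. \<exists>k. x - nsmul k g \<in> T}"
  then obtain k where "x - nsmul k g \<in> T" by blast
  moreover have "x = x - nsmul k g + nsmul k g" by simp
  ultimately show "x \<in> {x + nsmul k g | x k. x \<in> T}" by blast
qed

text \<open>Add \<open>g\<close> to the generators of each cone in a partition of \<open>T\<close>. That the translates of \<open>T\<close> along \<open>g\<close>
  are pairwise disjoint makes \<open>g\<close> independent of these generators and keeps the enlarged cones
  disjoint from each other.\<close>

lemma cone_partitioned_add_ray:
  assumes "cone_partitioned T"
    and ray: "\<And>x y k. x \<in> T \<Longrightarrow> y \<in> T \<Longrightarrow> x = y + nsmul k g \<Longrightarrow> k = 0"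
  shows "cone_partitioned {x + nsmul k g | x k. x \<in> T}"
proof -
  obtain \<C> where \<C>: "finite \<C>" "disjoint \<C>" "\<Union>\<C> = T"
    "\<And>C. C \<in> \<C> \<Longrightarrow> \<exists>b G. finite G \<and> int_module.independent G \<and> C = cone b G"
    using assms(1) unfolding cone_partitioned_def by auto
  define E where "E C = {x + nsmul k g | x k. x \<in> C}" for C
  have E: "\<exists>b G. finite G \<and> int_module.independent G \<and> E C = cone b G" if C: "C \<in> \<C>" for C
  proof -
    obtain b G where bG: "finite G" "int_module.independent G" "C = cone b G"
      using \<C>(4)[OF C] by blast
    have "\<And>x y k. x \<in> cone b G \<Longrightarrow> y \<in> cone b G \<Longrightarrow> x = y + nsmul k g \<Longrightarrow> k = 0"
      using ray C \<C>(3) bG(3) by blast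
    note ind = independent_insert_ray[OF bG(1,2) this]
    have "E C = cone b (insert g G)"
    proof (intro set_eqI)
      fix x
      have "x \<in> E C \<longleftrightarrow> (\<exists>k. x - nsmul k g \<in> cone b G)"
        unfolding E_def bG(3) ray_translates by simp
      also have "\<dots> \<longleftrightarrow> x \<in> cone b (insert g G)"
      proof -
        have "x - nsmul k g \<in> cone b G \<longleftrightarrow> x \<in> cone (b + nsmul k g) G" for k
          by (simp add: cone_translate[of _ b] cone_translate[of x "b + _"] algebra_simps)
        then show ?thesis using cone_insert[OF bG(1) ind(1)] by simp
      qed
      finally show "x \<in> E C \<longleftrightarrow> x \<in> cone b (insert g G)" .
    qed
    with ind(2) bG(1) show ?thesis
      by (intro exI[of _ b] exI[of _ "insert g G"]) simp
  qed
  have disj: "E C \<inter> E D = {}" if "C \<in> \<C>" "D \<in> \<C>" "C \<noteq> D" for C D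
  proof -
    have sub: "x = y" if "x \<in> T" "y \<in> T" "x + nsmul k g = y + nsmul l g" "k \<le> l" for x y k l
    proof -
      have "nsmul l g = nsmul k g + nsmul (l - k) g"
        using that(4) by (simp add: nsmul_add_left[symmetric])
      then have "x = y + nsmul (l - k) g"
        using that(3) by (simp add: algebra_simps)
      then show ?thesis using ray[OF that(1,2)] by fastforce
    qed
    have "x = y" if "x \<in> C" "y \<in> D" "x + nsmul k g = y + nsmul l g" for x y k l
      using sub[of x y k l] sub[of y x l k] that \<open>C \<in> \<C>\<close> \<open>D \<in> \<C>\<close> \<C>(3)
      by (metis UnionI nat_le_linear)
    moreover have "C \<inter> D = {}" using that \<C>(2) unfolding disjoint_def by blast
    ultimately show ?thesis unfolding E_def by blast
  qed
  have "{x + nsmul k g | x k. x \<in> T} = \<Union>(E ` \<C>)"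
    unfolding E_def \<C>(3)[symmetric] by blast
  moreover have "disjoint (E ` \<C>)" using disj unfolding disjoint_def by blast
  ultimately show ?thesis
    unfolding cone_partitioned_def using \<C>(1) E
    by (intro exI[of _ "E ` \<C>"]) simp
qed

text \<open>Slice along a generator \<open>h\<close>: let \<open>R n\<close> consist of the points that lie in the \<open>n\<close>-th slice \<open>P n\<close>
  but neither in \<open>Z\<close> nor in an earlier slice. By induction each \<open>R n\<close> is partitioned into cones with the
  remaining generators. Seen from the apex of its slice, the complement \<open>U n\<close> of \<open>R n\<close> is an
  ideal of the monoid generated by \<open>G\<close>, and these ideals increase with \<open>n\<close>, because
  adding \<open>h\<close> maps \<open>Z\<close> into \<open>Z\<close> and each slice into the next. By \<open>finite_basis\<close> they stabilise, say at
  \<open>N\<close>. From then on \<open>R (N + k)\<close> is \<open>R N\<close> translated by \<open>k h\<close>, so the tail is \<open>R N\<close> plus a ray. The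
  sets \<open>R n\<close> are pairwise disjoint by construction, and this makes \<open>h\<close> independent of
  the generators of the cones in \<open>R N\<close>.\<close>

lemma cone_partitioned_Diff:
  fixes Z :: "'a::ab_group_add set"
  assumes "finite G" "\<And>z g. z \<in> Z \<Longrightarrow> g \<in> G \<Longrightarrow> z + g \<in> Z"
  shows "cone_partitioned (cone b G - Z)"
  using assms
proof (induction G arbitrary: b Z)
  case empty
  then show ?case
    using cone_partitioned_empty cone_partitioned_singleton[of b]
    by (cases "b \<in> Z") (simp_all add: insert_Diff_if)
next
  case (insert h G)
  note fin = \<open>finite G\<close>
  define P where "P n = cone (b + nsmul n h) G" for n
  define W where "W n = Z \<union> (\<Union>m<n. P m)" for n
  define R where "R n = P n - W n" for n
  define U where "U n = {y \<in> cone 0 G. b + nsmul n h + y \<in> W n}" for n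
  have Wstep: "z + g \<in> W n" if "z \<in> W n" "g \<in> G" for z g n
    using that insert.prems cone_add_generator[OF fin _ that(2)] unfolding W_def P_def by blast
  have Wclosed: "z + y \<in> W n" if "z \<in> W n" "y \<in> cone 0 G" for z y n
    by (rule closed_add_cone[OF fin Wstep that])
  have P: "x \<in> P n \<longleftrightarrow> x - (b + nsmul n h) \<in> cone 0 G" for x n
    unfolding P_def by (rule cone_translate)
  have R: "x \<in> R n \<longleftrightarrow> x - (b + nsmul n h) \<in> cone 0 G - U n" for x n
    unfolding R_def U_def by (auto simp: P)
  have "U n \<subseteq> U (Suc n)" for n
  proof
    fix y assume y: "y \<in> U n"
    have "x + h \<in> W (Suc n)" if "x \<in> W n" for x
    proof (cases "x \<in> Z")
      case True
      then show ?thesis using insert.prems by (auto simp: W_def)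
    next
      case False
      then obtain m where m: "m < n" "x \<in> P m" using \<open>x \<in> W n\<close> by (auto simp: W_def)
      then have "x + h \<in> P (Suc m)" by (simp add: P algebra_simps)
      then show ?thesis using m(1) by (auto simp: W_def)
    qed
    then have "b + nsmul n h + y + h \<in> W (Suc n)" using y unfolding U_def by blast
    then show "y \<in> U (Suc n)" using y unfolding U_def by (simp add: algebra_simps)
  qed
  then have Umono: "U m \<subseteq> U n" if "m \<le> n" for m n
    using that by (rule lift_Suc_mono_le)
  have "\<exists>i j. i < j \<and> s j - s i \<in> cone 0 G" if "\<And>n. s n \<in> (\<Union>n. U n)" for s :: "nat \<Rightarrow> 'a"
    using that by (intro cone_good_pair[OF fin]) (auto simp: U_def)
  then obtain B where B: "finite B" "B \<subseteq> (\<Union>n. U n)"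
    "\<forall>x\<in>(\<Union>n. U n). \<exists>y\<in>B. x - y \<in> cone 0 G"
    using finite_basis[of "\<Union>n. U n" "cone 0 G"] by auto
  have "\<exists>N. B \<subseteq> U N"
    using B(1,2)
  proof (induction B)
    case (insert y B)
    then obtain N M where "B \<subseteq> U N" "y \<in> U M" by auto
    then have "insert y B \<subseteq> U (max N M)"
      using Umono[of N "max N M"] Umono[of M "max N M"] by auto
    then show ?case by blast
  qed simp
  then obtain N where N: "B \<subseteq> U N" by blast
  have UN: "U n = U N" if "N \<le> n" for n
  proof
    show "U n \<subseteq> U N"
    proof
      fix x assume x: "x \<in> U n"
      then obtain y where y: "y \<in> B" "x - y \<in> cone 0 G" using B(3) by blast
      then have "b + nsmul N h + y \<in> W N" using N unfolding U_def by blast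
      then have "b + nsmul N h + y + (x - y) \<in> W N" using y(2) by (rule Wclosed)
      then show "x \<in> U N" using x by (simp add: U_def)
    qed
  qed (rule Umono[OF that])
  have shift: "x \<in> R (N + k) \<longleftrightarrow> x - nsmul k h \<in> R N" for x k
    unfolding R using UN[of "N + k"] by (simp add: nsmul_add_left algebra_simps)
  have Rdisj: "R m \<inter> R n = {}" if "m < n" for m n
    using that unfolding R_def W_def by blast
  have Rpart: "cone_partitioned (R n)" for n
    unfolding R_def P_def
    by (rule insert.IH[OF Wstep])
  have "cone b (insert h G) - Z = (\<Union>n. R n)"
  proof -
    have "\<exists>n. x \<in> R n" if x: "x \<in> P n" "x \<notin> Z" for x n
    proof -
      have "x \<in> P (LEAST n. x \<in> P n)" using x(1) by (rule LeastI)
      moreover have "x \<notin> P m" if "m < (LEAST n. x \<in> P n)" for m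
        using that by (rule not_less_Least)
      ultimately show ?thesis using x(2) unfolding R_def W_def by blast
    qed
    then show ?thesis
      unfolding cone_insert[OF fin insert.hyps(2)] P_def[symmetric] by (auto simp: R_def W_def)
  qed
  also have "(\<Union>n. R n) = (\<Union>n<N. R n) \<union> {x + nsmul k h | x k. x \<in> R N}"
  proof -
    have "{x + nsmul k h | x k. x \<in> R N} = (\<Union>k. R (N + k))"
      unfolding ray_translates using shift by blast
    moreover have "(\<Union>n. R n) = (\<Union>n<N. R n) \<union> (\<Union>k. R (N + k))"
    proof -
      have "R n \<subseteq> (\<Union>n<N. R n) \<union> (\<Union>k. R (N + k))" for n
      proof (cases "n < N")
        case False
        then obtain k where "n = N + k" using le_Suc_ex[of N n] by auto
        then show ?thesis by auto
      qed auto
      then show ?thesis by auto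
    qed
    ultimately show ?thesis by simp
  qed
  also have "cone_partitioned \<dots>"
  proof (rule cone_partitioned_Un)
    show "cone_partitioned (\<Union>n<N. R n)"
      using Rpart Rdisj by (intro cone_partitioned_UN) (auto simp: disjoint_family_on_def neq_iff)
    show "cone_partitioned {x + nsmul k h | x k. x \<in> R N}"
    proof (rule cone_partitioned_add_ray[OF Rpart])
      fix x y k assume "x \<in> R N" "y \<in> R N" "x = y + nsmul k h"
      then have "x \<in> R N \<inter> R (N + k)" using shift[of x k] by simp
      then show "k = 0" using Rdisj[of N "N + k"] by (cases k) auto
    qed
    show "(\<Union>n<N. R n) \<inter> {x + nsmul k h | x k. x \<in> R N} = {}"
    proof -
      have "x + nsmul k h \<in> R (N + k)" if "x \<in> R N" for x k
        using that shift[of "x + nsmul k h" k] by simp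
      then have "x + nsmul k h \<notin> R n" if "x \<in> R N" "n < N" for x k n
        using that Rdisj[of n "N + k"] by auto
      then show ?thesis by auto
    qed
  qed
  finally show ?case .
qed

text \<open>The union of the cones already treated is closed under adding generators, precisely because all
  cones share the same generators, so it may be subtracted from the next one.\<close>

lemma cone_partitioned_UN_cones:
  fixes G :: "'a::ab_group_add set"
  assumes "finite G" "finite B"
  shows "cone_partitioned (\<Union>b\<in>B. cone b G)"
  using assms(2)
proof (induction B)
  case (insert b B)
  have "cone_partitioned (cone b G - (\<Union>b\<in>B. cone b G))"
    using cone_add_generator[OF assms(1)] by (intro cone_partitioned_Diff[OF assms(1)]) blast
  then have "cone_partitioned ((\<Union>b\<in>B. cone b G) \<union> (cone b G - (\<Union>b\<in>B. cone b G)))"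
    by (rule cone_partitioned_Un[OF insert.IH]) blast
  then show ?case by (simp add: Un_commute)
qed (simp add: cone_partitioned_empty)

section \<open>Presburger sets in the orthant are partitioned into cones\<close>

text \<open>Translation by \<open>t\<close> permutes the group, so it does not change the sum of all its
  elements.\<close>

lemma nsmul_CARD:
  fixes t :: "'t::{finite, ab_group_add}"
  shows "nsmul (CARD('t)) t = 0"
proof -
  have "bij (\<lambda>u. u + t)"
    by (rule bij_betw_byWitness[where f' = "\<lambda>u. u - t"]) auto
  then have "(\<Sum>u\<in>UNIV. u) = (\<Sum>u\<in>UNIV. u + t)"
    using sum.reindex_bij_betw[of "\<lambda>u. u + t" UNIV UNIV "\<lambda>u. u"] by simp
  also have "\<dots> = (\<Sum>u\<in>UNIV. u) + nsmul (CARD('t)) t"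
  proof -
    have "(\<Sum>u\<in>A. t) = nsmul (card A) t" if "finite A" for A :: "'t set"
      using that by induction simp_all
    then show ?thesis by (simp add: sum.distrib)
  qed
  finally show ?thesis by simp
qed

lemma zsmul_vec: "zsmul k x $ i = k * x $ i" for x :: "int ^ 'd"
  by (rule additive_zsmul) (simp add: Modules.additive_def)

lemma additive_coord: "Modules.additive (\<lambda>x. fst x $ i)"
  by (simp add: Modules.additive_def)

definition orthant :: "((int ^ 'd) \<times> 't) set" where
  "orthant = {x. \<forall>i. 0 \<le> fst x $ i}"

text \<open>Directions in which a point of the orthant can move without changing its class modulo
  \<open>m\<close> and without decreasing any functional of \<open>L\<close>. The torsion part is required to vanish, so that
  \<open>0\<close> is the only element with coordinate sum \<open>0\<close>.\<close>

definition congruent_cone ::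
    "int \<Rightarrow> ((int ^ 'd::finite) \<times> 't::ab_group_add \<Rightarrow> int) set \<Rightarrow> ((int ^ 'd) \<times> 't) set" where
  "congruent_cone m L = {h \<in> orthant. snd h = 0 \<and> (\<forall>i. m dvd fst h $ i) \<and> (\<forall>f\<in>L. 0 \<le> f h)}"

lemma congruent_cone_zsmul:
  assumes "h \<in> congruent_cone m L"
  obtains z where "h = zsmul m z"
proof -
  have "h = zsmul m (\<chi> i. fst h $ i div m, 0)"
    using assms unfolding congruent_cone_def
    by (simp add: prod_eq_iff fst_zsmul snd_zsmul vec_eq_iff zsmul_vec)
  then show ?thesis by (rule that)
qed

lemma congruent_cone_zero:
  assumes "\<And>f. f \<in> L \<Longrightarrow> Modules.additive f"
  shows "0 \<in> congruent_cone m L"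
proof -
  have "0 \<le> f 0" if "f \<in> L" for f
    by (simp add: additive.zero[OF assms[OF that]])
  then show ?thesis by (simp add: congruent_cone_def orthant_def)
qed

lemma congruent_cone_add:
  assumes "\<And>f. f \<in> L \<Longrightarrow> Modules.additive f" "x \<in> congruent_cone m L" "y \<in> congruent_cone m L"
  shows "x + y \<in> congruent_cone m L"
proof -
  have "0 \<le> f (x + y)" if "f \<in> L" for f
    using assms(2,3) that by (simp add: additive.add[OF assms(1)[OF that]] congruent_cone_def)
  then show ?thesis using assms(2,3) by (simp add: congruent_cone_def orthant_def)
qed

lemma congruent_cone_good_pair:
  fixes s :: "nat \<Rightarrow> (int ^ 'd::finite) \<times> 't::{finite, ab_group_add}"
  assumes "finite L" "\<And>f. f \<in> L \<Longrightarrow> Modules.additive f" "0 < m"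
    and s: "\<And>n. s n \<in> orthant" and bdd: "\<And>f n. f \<in> L \<Longrightarrow> \<beta> f \<le> f (s n)"
  shows "\<exists>i j. i < j \<and> s j - s i \<in> congruent_cone m L"
proof -
  define \<kappa> where "\<kappa> n = (\<chi> i. fst (s n) $ i mod m, snd (s n))" for n
  have fin: "finite (range \<kappa>)"
  proof (rule finite_subset)
    show "range \<kappa> \<subseteq> (\<lambda>f. \<chi> i. f i) ` (UNIV \<rightarrow>\<^sub>E {0..<m}) \<times> UNIV"
      using assms(3) by (auto simp: \<kappa>_def image_iff PiE_def intro!: bexI[of _ "\<lambda>i. _ i mod m"])
    show "finite ((\<lambda>f. \<chi> i. (f i :: int)) ` (UNIV \<rightarrow>\<^sub>E {0..<m} :: ('d \<Rightarrow> int) set) \<times> (UNIV :: 't set))"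
      by (intro finite_cartesian_product finite_imageI finite_PiE) auto
  qed
  (* Restrict to one residue class, then make all coordinates and all functionals
     non-decreasing; each functional in L becomes a natural number after subtracting its bound. *)
  obtain n0 where "infinite {n. \<kappa> n = \<kappa> n0}"
    using pigeonhole_infinite[OF infinite_UNIV_nat fin] by auto
  then obtain r :: "nat \<Rightarrow> nat" where r: "strict_mono r" "\<And>n. \<kappa> (r n) = \<kappa> n0"
    using infinite_enumerate by blast
  obtain t :: "nat \<Rightarrow> nat" where t: "strict_mono t"
    "\<forall>i\<in>UNIV. \<forall>m n. m \<le> n \<longrightarrow> nat (fst (s (r (t m))) $ i) \<le> nat (fst (s (r (t n))) $ i)"
    using Dickson[of "UNIV :: 'd set" "\<lambda>i n. nat (fst (s (r n)) $ i)", OF finite_class.finite_UNIV] by blast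
  obtain u :: "nat \<Rightarrow> nat" where u: "strict_mono u"
    "\<forall>f\<in>L. \<forall>m n. m \<le> n \<longrightarrow>
       nat (f (s (r (t (u m)))) - \<beta> f) \<le> nat (f (s (r (t (u n)))) - \<beta> f)"
    using Dickson[OF assms(1), of "\<lambda>f n. nat (f (s (r (t n))) - \<beta> f)"] by blast
  define a b where "a = r (t (u 0))" and "b = r (t (u 1))"
  have u01: "u 0 \<le> u 1" using u(1) by (simp add: strict_mono_less_eq)
  have "a < b"
    unfolding a_def b_def using r(1) t(1) u(1) by (simp add: strict_mono_less)
  moreover have "s b - s a \<in> congruent_cone m L"
  proof -
    have "fst (s a) $ i \<le> fst (s b) $ i" for i
      using t(2)[rule_format, OF UNIV_I u01, of i] s unfolding a_def b_def orthant_def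
      by (simp add: nat_le_eq_zle)
    moreover have "0 \<le> f (s b - s a)" if "f \<in> L" for f
      using u(2)[rule_format, OF that, of 0 1] bdd[OF that] unfolding a_def b_def
      by (simp add: nat_le_eq_zle additive.diff[OF assms(2)[OF that]])
    moreover have "\<kappa> a = \<kappa> b" unfolding a_def b_def using r(2) by simp
    then have "snd (s a) = snd (s b)" "\<And>i. fst (s b) $ i mod m = fst (s a) $ i mod m"
      by (auto simp: \<kappa>_def vec_eq_iff)
    ultimately show ?thesis
      by (simp add: congruent_cone_def orthant_def mod_eq_dvd_iff)
  qed
  ultimately show ?thesis by blast
qed

text \<open>Gordan's lemma. The elements of positive coordinate sum have a finite basis; subtracting
  a basis element lowers the sum, so descent on it ends at \<open>0\<close>.\<close>

lemma congruent_cone_finitely_generated: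
  fixes L :: "((int ^ 'd::finite) \<times> 't::{finite, ab_group_add} \<Rightarrow> int) set"
  assumes "finite L" "\<And>f. f \<in> L \<Longrightarrow> Modules.additive f" "0 < m"
  obtains G where "finite G" "congruent_cone m L = cone 0 G"
proof -
  define H where "H = congruent_cone m L"
  define size where "size h = (\<Sum>i\<in>UNIV. fst h $ i)" for h :: "(int ^ 'd) \<times> 't"
  have nonneg: "0 \<le> fst h $ i" if "h \<in> H" for h i
    using that by (auto simp: H_def congruent_cone_def orthant_def)
  have size0: "0 \<le> size h" if "h \<in> H" for h
    unfolding size_def using nonneg[OF that] by (simp add: sum_nonneg)
  have "\<exists>i j. i < j \<and> s j - s i \<in> H" if s: "\<And>n. s n \<in> {h \<in> H. 0 < size h}"
    for s :: "nat \<Rightarrow> (int ^ 'd) \<times> 't"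
    unfolding H_def
    by (rule congruent_cone_good_pair[OF assms, where \<beta> = "\<lambda>_. 0"])
      (use s in \<open>auto simp: H_def congruent_cone_def\<close>)
  then obtain B where B: "finite B" "B \<subseteq> {h \<in> H. 0 < size h}"
    "\<forall>h\<in>{h \<in> H. 0 < size h}. \<exists>b\<in>B. h - b \<in> H"
    using finite_basis[of "{h \<in> H. 0 < size h}" H] by auto
  have "h \<in> cone 0 B" if "h \<in> H" for h
    using that
  proof (induction "nat (size h)" arbitrary: h rule: less_induct)
    case less
    show ?case
    proof (cases "0 < size h")
      case True
      then obtain b where b: "b \<in> B" "h - b \<in> H" using B(3) less.prems by blast
      have "size h = size (h - b) + size b"
        unfolding size_def by (simp add: sum_subtractf)
      moreover have "0 < size b" using b B(2) by blast
      ultimately have "h - b \<in> cone 0 B"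
        using size0[OF b(2)] by (intro less.hyps b(2)) simp
      then show ?thesis
        using cone_add_generator[OF B(1) _ b(1)] by fastforce
    next
      case False
      then have "size h = 0" using size0[OF less.prems] by simp
      then have "fst h $ i = 0" for i
        using nonneg[OF less.prems] unfolding size_def by (simp add: sum_nonneg_eq_0_iff)
      then have "h = 0"
        using less.prems by (simp add: H_def congruent_cone_def prod_eq_iff vec_eq_iff)
      then show ?thesis using apex_in_cone by simp
    qed
  qed
  moreover have "cone 0 B \<subseteq> H"
    unfolding H_def
  proof (rule cone_least[OF B(1)])
    show "0 \<in> congruent_cone m L" by (rule congruent_cone_zero[OF assms(2)])
    show "x + g \<in> congruent_cone m L" if "x \<in> congruent_cone m L" "g \<in> B" for x g
      using congruent_cone_add[OF assms(2)] that B(2) H_def by blast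
  qed
  ultimately have "H = cone 0 B" by blast
  then show ?thesis using that B(1) unfolding H_def by blast
qed

text \<open>Dickson's lemma makes \<open>Y\<close> a finite union of translates of the monoid of directions, and by Gordan's lemma
  these translates are cones with the same finite generating set.\<close>

lemma cone_partitioned_module:
  fixes Y :: "((int ^ 'd::finite) \<times> 't::{finite, ab_group_add}) set"
  assumes L: "finite L" "\<And>f. f \<in> L \<Longrightarrow> Modules.additive f" "0 < m"
    and Y: "Y \<subseteq> orthant" and bdd: "\<And>f y. f \<in> L \<Longrightarrow> y \<in> Y \<Longrightarrow> \<beta> f \<le> f y"
    and closed: "\<And>y h. y \<in> Y \<Longrightarrow> h \<in> congruent_cone m L \<Longrightarrow> y + h \<in> Y"
  shows "cone_partitioned Y"
proof -
  obtain G where G: "finite G" "congruent_cone m L = cone 0 G"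
    using congruent_cone_finitely_generated[OF L] by blast
  have "\<exists>i j. i < j \<and> s j - s i \<in> congruent_cone m L" if s: "\<And>n. s n \<in> Y"
    for s :: "nat \<Rightarrow> (int ^ 'd) \<times> 't"
    by (rule congruent_cone_good_pair[OF L, where \<beta> = \<beta>]) (use s Y bdd in auto)
  then obtain B where B: "finite B" "B \<subseteq> Y" "\<forall>y\<in>Y. \<exists>b\<in>B. y - b \<in> congruent_cone m L"
    using finite_basis[of Y "congruent_cone m L"] by auto
  have "y \<in> Y \<longleftrightarrow> (\<exists>b\<in>B. y - b \<in> congruent_cone m L)" for y
  proof
    assume "\<exists>b\<in>B. y - b \<in> congruent_cone m L"
    then obtain b where "b \<in> Y" "y - b \<in> congruent_cone m L" using B(2) by blast
    then show "y \<in> Y" using closed[of b "y - b"] by simp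
  qed (use B(3) in blast)
  then have "y \<in> Y \<longleftrightarrow> (\<exists>b\<in>B. y \<in> cone b G)" for y
    by (simp only: G(2) cone_translate[symmetric])
  then have "Y = (\<Union>b\<in>B. cone b G)" by auto
  then show ?thesis
    using cone_partitioned_UN_cones[OF G(1) B(1)] by simp
qed

text \<open>Group the points of \<open>D\<close> by the set \<open>S\<close> of half-spaces that contain them. On such an atom
  every functional, with its sign reversed for the half-spaces outside \<open>S\<close>, is bounded below; directions
  in which all these functionals are non-negative preserve the atom.\<close>

lemma presburger_cone_partitioned:
  fixes D :: "((int ^ 'd::finite) \<times> 't::{finite, ab_group_add}) set"
  assumes "presburger D" "D \<subseteq> orthant"
  shows "cone_partitioned D"
proof -
  obtain F m where "controls F m D"
    using assms(1) unfolding presburger_def by blast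
  note F = controlsD(1,2)[OF this] and add = controlsD(3)[OF this] and ctrl = controlsD(4)[OF this]
  define atom where "atom S = {x \<in> D. {(f, c)\<in>F. c \<le> f x} = S}" for S
  have "cone_partitioned (atom S)" for S
  proof -
    define L where "L = fst ` (F \<inter> S) \<union> (\<lambda>(f, c) x. - f x) ` (F - S)"
    define Lc where "Lc = F \<inter> S \<union> (\<lambda>(f, c). (\<lambda>x. - f x, - c)) ` (F - S)"
    have Lc: "finite Lc" "L = fst ` Lc"
      using F(1) by (auto simp: Lc_def L_def image_image case_prod_beta image_Un)
    (* One functional may occur with several thresholds; the smallest is a valid bound. *)
    define \<beta> where "\<beta> f = Min (snd ` {p \<in> Lc. fst p = f})" for f
    have sgn: "c \<le> f x" if "x \<in> atom S" "(f, c) \<in> Lc" for x f c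
      using that unfolding atom_def Lc_def by (auto simp: not_le)
    have "\<beta> f \<le> f x" if fL: "f \<in> L" and x: "x \<in> atom S" for f x
    proof -
      obtain c where c: "(f, c) \<in> Lc" using fL Lc(2) by auto
      then have "\<beta> f \<le> c" unfolding \<beta>_def
        using Lc(1) by (intro Min_le) force+
      then show ?thesis using sgn[OF x c] by simp
    qed
    moreover have "x + h \<in> atom S" if x: "x \<in> atom S" and h: "h \<in> congruent_cone m L" for x h
    proof -
      obtain z where z: "h = zsmul m z" using congruent_cone_zsmul[OF h] .
      have sgn: "c \<le> f x \<longleftrightarrow> (f, c) \<in> S" "c \<le> f (x + h) \<longleftrightarrow> (f, c) \<in> S" if fc: "(f, c) \<in> F" for f c
      proof -
        show 1: "c \<le> f x \<longleftrightarrow> (f, c) \<in> S" using x fc unfolding atom_def by auto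
        have fh: "f (x + h) = f x + f h" by (rule additive.add[OF add[OF fc]])
        show "c \<le> f (x + h) \<longleftrightarrow> (f, c) \<in> S"
        proof (cases "(f, c) \<in> S")
          case True
          then have "f \<in> L" using fc unfolding L_def by force
          then have "0 \<le> f h" using h by (simp add: congruent_cone_def)
          then show ?thesis using 1 True fh by simp
        next
          case False
          then have "(\<lambda>x. - f x) \<in> L" using fc unfolding L_def by force
          moreover have "\<forall>f\<in>L. 0 \<le> f h" using h by (simp add: congruent_cone_def)
          ultimately have "0 \<le> - f h" by (rule bspec[rotated])
          then show ?thesis using 1 False fh by simp
        qed
      qed
      have "x \<in> D \<longleftrightarrow> x + h \<in> D"
        unfolding z by (rule ctrl) (use sgn z in simp)
      moreover have "{(f, c)\<in>F. c \<le> f (x + h)} = {(f, c)\<in>F. c \<le> f x}" using sgn by auto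
      ultimately show ?thesis using x unfolding atom_def by simp
    qed
    moreover have "finite L" "\<And>f. f \<in> L \<Longrightarrow> Modules.additive f"
      using F(1) add unfolding L_def by (auto intro: additive_uminus)
    moreover have "atom S \<subseteq> orthant" using assms(2) unfolding atom_def by blast
    ultimately show ?thesis using cone_partitioned_module[of L m "atom S" \<beta>] F(2) by blast
  qed
  then have "cone_partitioned (\<Union>S\<in>Pow F. atom S)"
    by (intro cone_partitioned_UN) (auto simp: F(1) disjoint_family_on_def atom_def)
  moreover have "(\<Union>S\<in>Pow F. atom S) = D"
  proof (intro equalityI subsetI)
    fix x assume "x \<in> D"
    then have "x \<in> atom {(f, c)\<in>F. c \<le> f x}" by (simp add: atom_def)
    moreover have "{(f, c)\<in>F. c \<le> f x} \<in> Pow F" by blast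
    ultimately show "x \<in> (\<Union>S\<in>Pow F. atom S)" by (rule UN_I[rotated])
  qed (simp add: atom_def)
  ultimately show ?thesis by simp
qed

section \<open>Descending from \<open>\<int>\<^sup>d \<oplus> T\<close> to \<open>\<nat>\<^sup>d \<oplus> T\<close>\<close>

lemma to_group_add: "to_group (x + y) = to_group x + to_group y"
  by (simp add: to_group_def vec_eq_iff)

lemma to_group_zero: "to_group 0 = 0"
  by (simp add: to_group_def vec_eq_iff prod_eq_iff)

lemma to_group_nsmul: "to_group (nsmul n x) = nsmul n (to_group x)"
  by (induction n) (simp_all add: to_group_zero to_group_add)

lemma to_group_sum: "to_group (\<Sum>i\<in>I. f i) = (\<Sum>i\<in>I. to_group (f i))"
  by (induction I rule: infinite_finite_induct) (simp_all add: to_group_zero to_group_add)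

lemma inj_to_group: "inj to_group"
  by (auto simp: inj_def to_group_def vec_eq_iff prod_eq_iff)

lemma range_to_group: "range to_group = (orthant :: ((int ^ 'd) \<times> 't) set)"
proof
  show "orthant \<subseteq> range (to_group :: _ \<Rightarrow> (int ^ 'd) \<times> 't)"
  proof
    fix x :: "(int ^ 'd) \<times> 't" assume "x \<in> orthant"
    then have "x = to_group (\<chi> i. nat (fst x $ i), snd x)"
      by (simp add: to_group_def orthant_def prod_eq_iff vec_eq_iff)
    then show "x \<in> range to_group" by blast
  qed
qed (auto simp: to_group_def orthant_def)

lemma to_group_cone:
  assumes "finite G"
  shows "to_group ` cone b G = cone (to_group b) (to_group ` G)"
proof -
  have eq: "to_group (b + (\<Sum>g\<in>G. nsmul (c (to_group g)) g))
      = to_group b + (\<Sum>h\<in>to_group ` G. nsmul (c h) h)" for c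
    by (simp add: to_group_add to_group_sum to_group_nsmul sum.reindex inj_on_subset[OF inj_to_group])
  show ?thesis
  proof (intro equalityI subsetI)
    fix x assume "x \<in> to_group ` cone b G"
    then obtain c where c: "x = to_group (b + (\<Sum>g\<in>G. nsmul (c g) g))"
      unfolding cone_def by blast
    have "x = to_group b + (\<Sum>h\<in>to_group ` G. nsmul (c (inv to_group h)) h)"
      unfolding c eq[symmetric] by (simp add: inj_to_group)
    then show "x \<in> cone (to_group b) (to_group ` G)"
      by (simp only:) (rule coneI)
  next
    fix x assume "x \<in> cone (to_group b) (to_group ` G)"
    then obtain c where "x = to_group (b + (\<Sum>g\<in>G. nsmul (c (to_group g)) g))"
      unfolding cone_def eq[symmetric] by blast
    moreover have "b + (\<Sum>g\<in>G. nsmul (c (to_group g)) g) \<in> cone b G"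
      by (rule coneI)
    ultimately show "x \<in> to_group ` cone b G" by blast
  qed
qed

text \<open>A cone contained in the orthant has its apex and all its generators there: a negative
  coordinate of a generator would make that coordinate negative far along its ray.\<close>

lemma is_cone_vimage:
  fixes G :: "((int ^ 'd::finite) \<times> 't::ab_group_add) set"
  assumes "finite G" "int_module.independent G" "cone b G \<subseteq> orthant"
  shows "is_cone (to_group -` cone b G)"
proof -
  have "b \<in> orthant" using assms(3) apex_in_cone by blast
  then obtain b0 where b0: "b = to_group b0" unfolding range_to_group[symmetric] by blast
  have "g \<in> orthant" if g: "g \<in> G" for g
  proof -
    have ray: "b + nsmul n g \<in> cone b G" for n
    proof (induction n)
      case (Suc n)
      then show ?case
        using cone_add_generator[OF assms(1) Suc g] by (simp add: ac_simps)
    qed (simp add: apex_in_cone)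
    have "0 \<le> fst g $ i" for i
    proof -
      have "0 \<le> fst b $ i + int n * fst g $ i" for n
        using subsetD[OF assms(3) ray[of n]]
        by (auto simp: orthant_def additive_nsmul[OF additive_coord, symmetric] nsmul_int[symmetric])
      from this[of "nat (fst b $ i + 1)"] show ?thesis
        by (smt (verit) int_nat_eq mult_minus_right mult_le_cancel_left1 mult_nonneg_nonpos)
    qed
    then show ?thesis by (simp add: orthant_def)
  qed
  moreover define G0 where "G0 = to_group -` G"
  ultimately have G: "to_group ` G0 = G"
    unfolding G0_def by (subst image_vimage_eq) (auto simp: range_to_group)
  have fin: "finite G0"
    unfolding G0_def by (rule finite_vimageI[OF assms(1) inj_to_group])
  have "cone b G = to_group ` cone b0 G0"
    using to_group_cone[OF fin, of b0] by (simp add: G b0)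
  then have "to_group -` cone b G = cone b0 G0"
    by (simp add: inj_vimage_image_eq[OF inj_to_group])
  moreover have "int_module.independent (to_group ` G0)"
    using assms(2) G by simp
  ultimately show ?thesis
    unfolding is_cone_def using fin by blast
qed

section \<open>Factorization lengths as a Presburger set\<close>

lemma factorizations_Cons:
  "n # l \<in> factorizations (a # as) x \<longleftrightarrow> (\<exists>y. x = nsmul n a + y \<and> l \<in> factorizations as y)"
  unfolding factorizations_def by (auto simp: sum.lessThan_Suc_shift simp del: sum.lessThan_Suc)

lemma length_set_Nil: "length_set [] x = (if x = 0 then {0} else {})"
  by (auto simp: length_set_def factorizations_def image_iff)

lemma length_set_Cons:
  "l \<in> length_set (a # as) x \<longleftrightarrow> (\<exists>n k y. x = nsmul n a + y \<and> k \<in> length_set as y \<and> l = n + k)"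
proof
  assume "l \<in> length_set (a # as) x"
  then obtain c where c: "c \<in> factorizations (a # as) x" "l = sum_list c"
    unfolding length_set_def by blast
  then obtain n c' where "c = n # c'"
    unfolding factorizations_def by (cases c) auto
  then show "\<exists>n k y. x = nsmul n a + y \<and> k \<in> length_set as y \<and> l = n + k"
    using c unfolding length_set_def by (auto simp: factorizations_Cons)
next
  assume "\<exists>n k y. x = nsmul n a + y \<and> k \<in> length_set as y \<and> l = n + k"
  then obtain n c y where "x = nsmul n a + y" "c \<in> factorizations as y" "l = n + sum_list c"
    unfolding length_set_def by blast
  then have "n # c \<in> factorizations (a # as) x" "l = sum_list (n # c)"
    by (auto simp: factorizations_Cons)
  then show "l \<in> length_set (a # as) x"
    unfolding length_set_def by blast
qed

lemma length_set_nonempty_imp_generated: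
  assumes "l \<in> length_set as x"
  shows "x \<in> submonoid_gen (set as)"
  using assms
proof (induction as arbitrary: x l)
  case Nil
  then show ?case by (simp add: length_set_Nil submonoid_gen.zero split: if_splits)
next
  case (Cons a as)
  have mono: "y \<in> submonoid_gen (set (a # as))" if "y \<in> submonoid_gen (set as)" for y
    using that by induction (auto intro: submonoid_gen.intros)
  have "nsmul n a \<in> submonoid_gen (set (a # as))" for n
    by (induction n) (auto intro: submonoid_gen.intros)
  then show ?case
    using Cons mono unfolding length_set_Cons by (auto intro: submonoid_gen.add)
qed

text \<open>The second component of a point is an integer, not a natural number, so that the graph is a
  subset of a group.\<close>

definition length_graph ::
    "((nat ^ 'd::finite) \<times> 't::ab_group_add) list \<Rightarrow> (((int ^ 'd) \<times> 't) \<times> int) set" where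
  "length_graph as = {(to_group x, int l) | x l. l \<in> length_set as x}"

text \<open>The free coordinates vanish if \<open>0 \<le> f x\<close> holds and \<open>1 \<le> f x\<close> fails for each of them; the torsion
  part is constant on classes modulo the order of \<open>T\<close>.\<close>

lemma presburger_zero:
  "presburger {0 :: ((int ^ 'd::finite) \<times> 't::{finite, ab_group_add}) \<times> int}"
proof -
  define coords where "coords = insert snd (range (\<lambda>i (p :: ((int ^ 'd) \<times> 't) \<times> int). fst (fst p) $ i))"
  define F where "F = coords \<times> {0, 1 :: int}"
  have add: "Modules.additive f" if "f \<in> coords" for f
    using that unfolding coords_def by (auto simp: Modules.additive_def)
  have step: "x + zsmul (int CARD('t)) z = 0"
    if "x = 0" and agree: "\<forall>(f, c)\<in>F. c \<le> f x \<longleftrightarrow> c \<le> f (x + zsmul (int CARD('t)) z)" for x z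
  proof -
    let ?y = "x + zsmul (int CARD('t)) z"
    have zero: "f ?y = 0" if f: "f \<in> coords" for f
    proof -
      have "0 \<le> f x \<longleftrightarrow> 0 \<le> f ?y" "1 \<le> f x \<longleftrightarrow> 1 \<le> f ?y"
        using agree f unfolding F_def by auto
      then show ?thesis using \<open>x = 0\<close> additive.zero[OF add[OF f]] by simp
    qed
    have "snd ?y = 0" by (rule zero) (simp add: coords_def)
    moreover have "fst (fst ?y) $ i = 0" for i by (rule zero) (simp add: coords_def)
    moreover have "snd (fst ?y) = 0"
      using \<open>x = 0\<close> by (simp add: zsmul_of_nat fst_nsmul snd_nsmul nsmul_CARD)
    ultimately show ?thesis
      by (simp only: prod_eq_iff vec_eq_iff fst_zero snd_zero zero_index simp_thms)
  qed
  have "x \<in> {0} \<longleftrightarrow> x + zsmul (int CARD('t)) z \<in> {0}"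
    if agree: "\<forall>(f, c)\<in>F. c \<le> f x \<longleftrightarrow> c \<le> f (x + zsmul (int CARD('t)) z)" for x z
  proof
    assume "x \<in> {0}"
    then show "x + zsmul (int CARD('t)) z \<in> {0}" using step agree by blast
  next
    assume "x + zsmul (int CARD('t)) z \<in> {0}"
    moreover have "x + zsmul (int CARD('t)) z + zsmul (int CARD('t)) (- z) = x" by simp
    ultimately show "x \<in> {0}"
      using step[of "x + zsmul (int CARD('t)) z" "- z"] agree by auto
  qed
  moreover have "finite F" "\<forall>(f, c)\<in>F. Modules.additive f"
    unfolding F_def using add by (auto simp: coords_def)
  ultimately have "controls F (int CARD('t)) {0}"
    unfolding controls_def by simp
  then show ?thesis unfolding presburger_def by blast
qed

text \<open>Each generator \<open>a\<close> contributes the ray spanned by \<open>(a, 1)\<close>.\<close>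

lemma presburger_length_graph:
  fixes as :: "((nat ^ 'd::finite) \<times> 't::{finite, ab_group_add}) list"
  shows "presburger (length_graph as)"
proof (induction as)
  case Nil
  have Nil_iff: "l \<in> length_set [] x \<longleftrightarrow> x = 0 \<and> l = 0" for x :: "(nat ^ 'd) \<times> 't" and l
    by (simp add: length_set_Nil)
  have "length_graph [] = {(to_group (0 :: (nat ^ 'd) \<times> 't), int 0)}"
    unfolding length_graph_def Nil_iff by blast
  also have "\<dots> = {0}"
    by (simp only: to_group_zero zero_prod_def[symmetric] of_nat_0)
  finally show ?case by (simp only: presburger_zero)
next
  case (Cons a as)
  have "p \<in> length_graph (a # as) \<longleftrightarrow> (\<exists>n. p - nsmul n (to_group a, 1) \<in> length_graph as)" for p
  proof
    assume "p \<in> length_graph (a # as)"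
    then obtain n k y where "p = (to_group (nsmul n a + y), int (n + k))" "k \<in> length_set as y"
      unfolding length_graph_def length_set_Cons by blast
    then have "p - nsmul n (to_group a, 1) = (to_group y, int k)" "k \<in> length_set as y"
      by (simp_all add: nsmul_Pair nsmul_int to_group_add to_group_nsmul)
    then show "\<exists>n. p - nsmul n (to_group a, 1) \<in> length_graph as"
      unfolding length_graph_def by blast
  next
    assume "\<exists>n. p - nsmul n (to_group a, 1) \<in> length_graph as"
    then obtain n k y where "p - nsmul n (to_group a, 1) = (to_group y, int k)"
      and k: "k \<in> length_set as y"
      unfolding length_graph_def by blast
    then have "p = (to_group (nsmul n a + y), int (n + k))"
      by (simp add: nsmul_Pair nsmul_int to_group_add to_group_nsmul prod_eq_iff algebra_simps)
    moreover have "n + k \<in> length_set (a # as) (nsmul n a + y)"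
      using k length_set_Cons by blast
    ultimately show "p \<in> length_graph (a # as)"
      unfolding length_graph_def by blast
  qed
  then have "length_graph (a # as) = {p. \<exists>n. p - nsmul n (to_group a, 1) \<in> length_graph as}"
    by blast
  then show ?case using presburger_add_ray[OF Cons.IH] by simp
qed

lemma length_graph_iff:
  "(to_group x, k) \<in> length_graph as \<longleftrightarrow> 0 \<le> k \<and> nat k \<in> length_set as x"
proof -
  have "(to_group x, k) \<in> length_graph as \<longleftrightarrow> (\<exists>l. k = int l \<and> l \<in> length_set as x)"
    unfolding length_graph_def
    by (simp add: inj_eq[OF inj_to_group] del: split_paired_Ex)
  then show ?thesis by (auto intro: exI[of _ "nat k"])
qed

text \<open>The quantification over all lengths between two consecutive ones becomes a conjunction of \<open>j - 1\<close>
  conditions, which a finite intersection can express.\<close>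

lemma delta_iff:
  "j \<in> delta as x \<longleftrightarrow> 0 < j \<and>
     (\<exists>l. l \<in> length_set as x \<and> l + j \<in> length_set as x \<and> (\<forall>i\<in>{1..<j}. l + i \<notin> length_set as x))"
proof
  assume "j \<in> delta as x"
  then obtain l l' where l: "j = l' - l" "l \<in> length_set as x" "l' \<in> length_set as x" "l < l'"
    "length_set as x \<inter> {l<..<l'} = {}"
    unfolding delta_def successive_diffs_def by blast
  moreover have "l + i \<in> {l<..<l'}" if "i \<in> {1..<j}" for i
    using that l(1) by auto
  ultimately show "0 < j \<and>
     (\<exists>l. l \<in> length_set as x \<and> l + j \<in> length_set as x \<and> (\<forall>i\<in>{1..<j}. l + i \<notin> length_set as x))"
    by (intro conjI exI[of _ l]) auto
next
  assume "0 < j \<and>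
     (\<exists>l. l \<in> length_set as x \<and> l + j \<in> length_set as x \<and> (\<forall>i\<in>{1..<j}. l + i \<notin> length_set as x))"
  then obtain l where l: "0 < j" "l \<in> length_set as x" "l + j \<in> length_set as x"
    "\<And>i. i \<in> {1..<j} \<Longrightarrow> l + i \<notin> length_set as x"
    by blast
  have "k \<notin> {l<..<l + j}" if "k \<in> length_set as x" for k
  proof
    assume "k \<in> {l<..<l + j}"
    then have "k - l \<in> {1..<j}" "l + (k - l) = k" by auto
    then show False using l(4)[of "k - l"] that by simp
  qed
  then have "length_set as x \<inter> {l<..<l + j} = {}" by blast
  then show "j \<in> delta as x"
    unfolding delta_def successive_diffs_def using l
    by (intro CollectI exI[of _ "l + j"] exI[of _ l]) auto
qed

text \<open>The length \<open>l\<close> is eliminated by adding the ray spanned by \<open>(0, -1)\<close> and intersecting with the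
  hyperplane of second component \<open>0\<close>; one direction suffices because lengths are natural
  numbers.\<close>

lemma presburger_delta:
  fixes as :: "((nat ^ 'd::finite) \<times> 't::{finite, ab_group_add}) list"
  assumes "0 < j"
  shows "presburger (to_group ` {x. j \<in> delta as x})"
proof -
  let ?W = "length_graph as"
  let ?shift = "\<lambda>i. {p. p + (0, int i) \<in> ?W}"
  define X where "X = ?W \<inter> ?shift j \<inter> (\<Inter>i\<in>{1..<j}. - ?shift i)"
  have id: "Modules.additive (\<lambda>p :: ((int ^ 'd) \<times> 't) \<times> int. p)"
    by (simp add: Modules.additive_def)
  have shift: "presburger (?shift i)" for i
    using presburger_vimage[OF presburger_length_graph id] .
  have "presburger X"
    unfolding X_def
    by (intro presburger_Int presburger_INT presburger_Compl shift presburger_length_graph) simp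
  then have "presburger {p. \<exists>n. p - nsmul n (0, - 1) \<in> X}"
    by (rule presburger_add_ray)
  then have "presburger {v. (v, 0) + 0 \<in> {p. \<exists>n. p - nsmul n (0, - 1) \<in> X}}"
    by (rule presburger_vimage) (simp add: Modules.additive_def)
  moreover have "(v, 0) + 0 \<in> {p. \<exists>n. p - nsmul n (0, - 1) \<in> X} \<longleftrightarrow> v \<in> to_group ` {x. j \<in> delta as x}"
    for v
  proof -
    have X: "(to_group x, int n) \<in> X \<longleftrightarrow> n \<in> length_set as x \<and> n + j \<in> length_set as x \<and>
        (\<forall>i\<in>{1..<j}. n + i \<notin> length_set as x)" for x n
      unfolding X_def by (simp add: length_graph_iff nat_add_distrib)
    have "(v, 0) + 0 \<in> {p. \<exists>n. p - nsmul n (0, - 1) \<in> X} \<longleftrightarrow> (\<exists>n. (v, int n) \<in> X)"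
    proof -
      have "nsmul n 0 = (0 :: (int ^ 'd) \<times> 't)" for n by (simp add: nsmul_def)
      then show ?thesis by (simp add: nsmul_Pair nsmul_int)
    qed
    also have "\<dots> \<longleftrightarrow> (\<exists>x n. v = to_group x \<and> (to_group x, int n) \<in> X)"
    proof -
      have "\<exists>x. v = to_group x" if "(v, int n) \<in> X" for n
        using that unfolding X_def length_graph_def by blast
      then show ?thesis by blast
    qed
    also have "\<dots> \<longleftrightarrow> v \<in> to_group ` {x. j \<in> delta as x}"
      unfolding X delta_iff using assms by auto
    finally show ?thesis .
  qed
  ultimately show ?thesis by simp
qed

theorem corollary4p10:
  fixes as :: "((nat ^ 'd::finite) \<times> 't::{finite, ab_group_add}) list"
    and \<Gamma> :: "((nat ^ 'd) \<times> 't) set"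
    and j :: nat
  assumes "\<Gamma> = submonoid_gen (set as)"
    and "reduced_monoid \<Gamma>"
    and "minimal_generators as"
    and "j \<in> delta_monoid as"
  shows "\<exists>\<C>. finite \<C> \<and> (\<forall>C\<in>\<C>. is_cone C) \<and> disjoint \<C> \<and>
           {\<alpha> \<in> \<Gamma>. j \<in> delta as \<alpha>} = \<Union>\<C>"
proof -
  define D where "D = {x. j \<in> delta as x}"
  have "0 < j" using assms(4) unfolding delta_monoid_def by (auto simp: delta_iff)
  then have "presburger (to_group ` D)"
    unfolding D_def by (rule presburger_delta)
  moreover have sub: "to_group ` D \<subseteq> orthant"
    using range_to_group by blast
  ultimately have "cone_partitioned (to_group ` D)"
    by (rule presburger_cone_partitioned)
  then obtain \<C> where \<C>: "finite \<C>" "disjoint \<C>" "\<Union>\<C> = to_group ` D"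
    and cones: "\<And>C. C \<in> \<C> \<Longrightarrow> \<exists>b G. finite G \<and> int_module.independent G \<and> C = cone b G"
    unfolding cone_partitioned_def by (elim exE conjE) (rule that, auto)
  have "is_cone (to_group -` C)" if C: "C \<in> \<C>" for C
  proof -
    obtain b G where bG: "finite G" "int_module.independent G" "C = cone b G"
      using cones[OF C] by (elim exE conjE)
    have "cone b G \<subseteq> orthant" using C \<C>(3) sub bG(3) by blast
    then show ?thesis unfolding bG(3) by (rule is_cone_vimage[OF bG(1,2)])
  qed
  moreover have "disjoint ((-`) to_group ` \<C>)"
    using \<C>(2) unfolding disjoint_def by blast
  moreover have "{\<alpha> \<in> \<Gamma>. j \<in> delta as \<alpha>} = \<Union>((-`) to_group ` \<C>)"
  proof -
    have "{\<alpha> \<in> \<Gamma>. j \<in> delta as \<alpha>} = D"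
      unfolding D_def assms(1) delta_iff using length_set_nonempty_imp_generated by blast
    also have "D = to_group -` (\<Union>\<C>)"
      unfolding \<C>(3) by (rule inj_vimage_image_eq[OF inj_to_group, symmetric])
    finally show ?thesis by (simp add: vimage_Union)
  qed
  moreover have "finite ((-`) to_group ` \<C>)"
    using \<C>(1) by (rule finite_imageI)
  ultimately show ?thesis by blast
qed

end
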